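(* Assume $1<l<m-1$, and write $[m]=\{1,\dots,m\}$. (1) Every symmetric $t$-$(m,l,\lambda)$ block design $([m],\mathbb S)$ for which $m$ is a prime power yields a tight $(n,l)$-OGFF for $\mathbb C^m$, where $n=m(m+1)$, according to the following construction: take a family $\Pi_1,\dots,\Pi_{m+1}$ of mutually unbiased bases for $\mathbb C^m$ (such a family exists when $m$ is a prime power) and form the collection of block projections $\{P^{(k)}_{\mathcal J}: 1\le k\le m+1,\ \mathcal J\in\mathbb S\}$. (2) Every symmetric $t$-$(m,l,\lambda)$ block design $([m],\mathbb S)$ for which $m$ is a power of four yields a tight $(n,l)$-OGFF for $\mathbb R^m$, where $n=m(m/2+1)$, according to the following construction: take a family $\Pi_1,\dots,\Pi_{m/2+1}$ of mutually unbiased bases for $\mathbb R^m$ (such a family exists when $m$ is a power of four) and form the collection of block projections $\{P^{(k)}_{\mathcal J}: 1\le k\le m/2+1,\ \mathcal J\in\mathbb S\}$.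
   Context: Block designs: a $t$-$(m,l,\lambda)$ block design is a pair $([m],\mathbb S)$, where $\mathbb S$ is a collection of $b=|\mathbb S|$ subsets (blocks) of $[m]$, each of cardinality $l$, such that each element of $[m]$ lies in exactly $r$ blocks and every subset of $[m]$ of cardinality $t$ is contained in exactly $\lambda$ blocks. It is symmetric if $m=b$ or, equivalently, $l=r$. Packings: let $\mathbb F\in\{\mathbb R,\mathbb C\}$. An $(n,l)$-packing for $\mathbb F^m$ is a finite sequence $\mathcal P=\{P_j\}_{j=1}^n$ of rank-$l$ orthogonal projections on $\mathbb F^m$; its coherence is $\mu(\mathcal P)=\max_{j\neq j'}\operatorname{tr}(P_jP_{j'})$. It is an $(n,l)$-fusion frame for $\mathbb F^m$ if $\sum_jP_j$ is positive definite, and it is tight if $\sum_{j=1}^nP_j=\frac{nl}{m}I_m$, where $I_m$ is the $m\times m$ identity matrix. Put $d_{\mathbb R^m}=\frac{(m+2)(m-1)}{2}$ and $d_{\mathbb C^m}=m^2-1$. An $(n,l)$-OGFF (orthoplectic Grassmannian fusion frame) for $\mathbb F^m$ is an $(n,l)$-fusion frame $\mathcal P$ for $\mathbb F^m$ with $n>d_{\mathbb F^m}+1$ and $\mu(\mathcal P)=\frac{l^2}{m}$. Mutually unbiased bases: tight $(m,1)$-fusion frames $\Pi_k=\{\pi^{(k)}_j\}_{j=1}^m$ for $\mathbb F^m$ (that is, the rank-one projections onto the vectors of orthonormal bases) are mutually unbiased bases if $\operatorname{tr}(\pi_j^{(s)}\pi_{j'}^{(k)})=\frac1m$ for all $j,j'$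 whenever $s\ne k$. For a block $\mathcal J\in\mathbb S$, the $\mathcal J$-block projection with respect to $\Pi_k$ is $P_{\mathcal J}^{(k)}=\sum_{j\in\mathcal J}\pi_j^{(k)}$.
   Formalization: The strength t of the design is required to satisfy 2 ≤ t ≤ l; for t = 1 the claim fails, e.g. for m = 5, l = 3 and the five cyclic shifts of {1,2,3}, where two blocks meet in 2 > 9/5 points. *)

theory Defs
  imports
    "HOL-Analysis.Analysis"
    "HOL-Number_Theory.Prime_Powers"
    "Jordan_Normal_Form.Conjugate"
begin

section \<open>Block designs\<close>

definition block_design :: "nat \<Rightarrow> nat \<Rightarrow> nat \<Rightarrow> nat \<Rightarrow> nat set set \<Rightarrow> bool" where
  "block_design t m l lam S \<longleftrightarrow>
     (\<forall>J\<in>S. J \<subseteq> {1..m} \<and> card J = l) \<and>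
     (\<exists>r. \<forall>j\<in>{1..m}. card {J\<in>S. j \<in> J} = r) \<and>
     (\<forall>T. T \<subseteq> {1..m} \<and> card T = t \<longrightarrow> card {J\<in>S. T \<subseteq> J} = lam)"

definition symmetric_block_design :: "nat \<Rightarrow> nat \<Rightarrow> nat \<Rightarrow> nat \<Rightarrow> nat set set \<Rightarrow> bool" where
  "symmetric_block_design t m l lam S \<longleftrightarrow> block_design t m l lam S \<and> card S = m"

section \<open>The scalar fields\<close>

text \<open>
  The two scalar fields are handled uniformly through a type class whose only intended instances
  are the real and the complex numbers. The order inherited from
  \<^class>\<open>conjugatable_ordered_field\<close> is, on the complex numbers, the partial order in which
  \<open>0 < z\<close> means that \<open>z\<close> is real and positive. The parameter \<open>herm_dim\<close> is the number
  \<open>d\<close> attached to each field; it is the real dimension of the space of self-adjoint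
  \<open>m \<times> m\<close> matrices of trace zero.
\<close>

class frame_scalar = conjugatable_ordered_field + real_field +
  fixes herm_dim :: "'a itself \<Rightarrow> nat \<Rightarrow> real"

instantiation real :: frame_scalar
begin
definition herm_dim_real :: "real itself \<Rightarrow> nat \<Rightarrow> real" where
  "herm_dim_real _ m = (real m + 2) * (real m - 1) / 2"
instance ..
end

instantiation complex :: frame_scalar
begin
definition herm_dim_complex :: "complex itself \<Rightarrow> nat \<Rightarrow> real" where
  "herm_dim_complex _ m = (real m)\<^sup>2 - 1"
instance ..
end

section \<open>Matrices\<close>

definition conj_transpose :: "'a::frame_scalar^'n^'m \<Rightarrow> 'a^'m^'n" where
  "conj_transpose A = (\<chi> i j. conjugate (A $ j $ i))"

definition orthogonal_projection :: "'a::frame_scalar^'m^'m \<Rightarrow> bool" where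
  "orthogonal_projection P \<longleftrightarrow> P ** P = P \<and> conj_transpose P = P"

definition positive_definite :: "'a::frame_scalar^'m^'m \<Rightarrow> bool" where
  "positive_definite A \<longleftrightarrow> conj_transpose A = A \<and>
     (\<forall>x. x \<noteq> 0 \<longrightarrow> 0 < (\<Sum>i\<in>UNIV. conjugate (x $ i) * (A *v x) $ i))"

section \<open>Packings and fusion frames\<close>

text \<open>
  A finite sequence of length \<open>n\<close> is represented by a family \<open>P\<close> over an arbitrary finite index
  set \<open>I\<close> of cardinality \<open>n\<close>; repetitions are allowed. The dimension \<open>m\<close> is \<open>CARD('m)\<close>.
\<close>

definition packing ::
    "nat \<Rightarrow> nat \<Rightarrow> 'i set \<Rightarrow> ('i \<Rightarrow> 'a::frame_scalar^'m^'m) \<Rightarrow> bool" where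
  "packing n l I P \<longleftrightarrow> finite I \<and> card I = n \<and>
     (\<forall>j\<in>I. orthogonal_projection (P j) \<and> rank (P j) = l)"

text \<open>
  The trace of a product of two orthogonal projections is a real number, so comparing it with
  \<^term>\<open>of_real c\<close> loses no pair of indices.
\<close>

definition coherence :: "'i set \<Rightarrow> ('i \<Rightarrow> 'a::frame_scalar^'m^'m) \<Rightarrow> real" where
  "coherence I P =
     Max {c. \<exists>j\<in>I. \<exists>j'\<in>I. j \<noteq> j' \<and> trace (P j ** P j') = of_real c}"

definition fusion_frame ::
    "nat \<Rightarrow> nat \<Rightarrow> 'i set \<Rightarrow> ('i \<Rightarrow> 'a::frame_scalar^'m^'m) \<Rightarrow> bool" where
  "fusion_frame n l I P \<longleftrightarrow> packing n l I P \<and> positive_definite (\<Sum>j\<in>I. P j)"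

definition tight ::
    "nat \<Rightarrow> nat \<Rightarrow> 'i set \<Rightarrow> ('i \<Rightarrow> 'a::frame_scalar^'m^'m) \<Rightarrow> bool" where
  "tight n l I P \<longleftrightarrow> (\<Sum>j\<in>I. P j) = mat (of_nat (n * l) / of_nat CARD('m))"

definition OGFF ::
    "nat \<Rightarrow> nat \<Rightarrow> 'i set \<Rightarrow> ('i \<Rightarrow> 'a::frame_scalar^'m^'m) \<Rightarrow> bool" where
  "OGFF n l I P \<longleftrightarrow> fusion_frame n l I P \<and>
     real n > herm_dim TYPE('a) CARD('m) + 1 \<and>
     coherence I P = (real l)\<^sup>2 / real CARD('m)"

section \<open>Mutually unbiased bases and block projections\<close>

text \<open>\<open>B k j\<close> is the \<open>j\<close>-th projection of the \<open>k\<close>-th basis, for \<open>1 \<le> k \<le> K\<close> and \<open>1 \<le> j \<le> m\<close>.\<close>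

definition mutually_unbiased_bases ::
    "nat \<Rightarrow> (nat \<Rightarrow> nat \<Rightarrow> 'a::frame_scalar^'m^'m) \<Rightarrow> bool" where
  "mutually_unbiased_bases K B \<longleftrightarrow>
     (\<forall>k\<in>{1..K}. fusion_frame CARD('m) 1 {1..CARD('m)} (B k) \<and>
                 tight CARD('m) 1 {1..CARD('m)} (B k)) \<and>
     (\<forall>s\<in>{1..K}. \<forall>k\<in>{1..K}. s \<noteq> k \<longrightarrow>
        (\<forall>j\<in>{1..CARD('m)}. \<forall>j'\<in>{1..CARD('m)}.
           trace (B s j ** B k j') = 1 / of_nat CARD('m)))"

definition block_projection ::
    "(nat \<Rightarrow> nat \<Rightarrow> 'a::frame_scalar^'m^'m) \<Rightarrow> nat \<times> nat set \<Rightarrow> 'a^'m^'m" where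
  "block_projection B = (\<lambda>(k, J). \<Sum>j\<in>J. B k j)"

end

theory Submission
  imports Defs "HOL-Algebra.Algebraic_Closure_Type" "Berlekamp_Zassenhaus.Finite_Field"
begin

text \<open>
  Two blocks of a symmetric design with \<open>t \<ge> 2\<close> meet in exactly \<open>l (l - 1) / (m - 1) \<le> l\<^sup>2 / m\<close> points,
  and block projections to different bases have trace product \<open>l\<^sup>2 / m\<close>; this gives the coherence.

  Mutually unbiased bases come from families of quadratic functions \<open>f s\<close> on a finite abelian
  group \<open>G\<close>, that is \<open>f s (x + y) = f s x * f s y * \<beta> s x y\<close> with a bicharacter \<open>\<beta> s\<close>. If the quotients
  \<open>\<beta> s / \<beta> t\<close> are nondegenerate, then the products of the \<open>f s\<close> with the characters of \<open>G\<close>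
  form, together with the standard basis, mutually unbiased bases, since Gauss sums have absolute value
  \<open>sqrt (card G)\<close>. On \<open>G = GF(q)\<close> one takes \<open>\<beta> s x y\<close> to be an additive character of \<open>s x y\<close>; the real
  case uses the Kerdock set of alternating forms on \<open>GF(2\<^sup>n) \<times> GF(2)\<close>.
\<close>

section \<open>Intersections of blocks\<close>

text \<open>The bounds \<open>2 \<le> t\<close> and \<open>t \<le> l\<close> are what lets the
  design condition control pairs of points: for \<open>t > l\<close> no block contains a set of size
  \<open>t\<close>, and for \<open>t \<le> 1\<close> the condition never looks at two points at
  once.

  Real scalars restrict the quadratic functions to the values 1 and -1, that is, to signs of
  quadratic forms over GF(2). Their polarisations are alternating, and a nonsingular alternating
  form needs even dimension; hence the powers of four and the extra coordinate GF(2) beside a field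
  of odd degree. An alternating matrix has zero diagonal, so its first row takes at most
  \<open>m / 2\<close> values, and forms with nonsingular differences have distinct first rows: this
  is why there are \<open>m / 2\<close> real forms against \<open>m\<close> complex ones.

  Both scalar fields are treated at once. Moduli and lengths therefore occur only as products with a
  conjugate, and no vector is normalised. The finite fields are sets of fixed points of Frobenius
  powers inside an algebraically closed field, because their order varies with
  \<open>CARD('m)\<close>; accordingly the groups are subsets of a type.\<close>

lemma card_subsets_between:
  assumes "finite A" "R \<subseteq> A" "card R \<le> t"
  shows "card {T. R \<subseteq> T \<and> T \<subseteq> A \<and> card T = t} = (card A - card R) choose (t - card R)"
proof -
  have fR: "finite R" using assms finite_subset by auto
  have "bij_betw (\<lambda>U. R \<union> U) {U. U \<subseteq> A - R \<and> card U = t - card R}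
          {T. R \<subseteq> T \<and> T \<subseteq> A \<and> card T = t}"
  proof (rule bij_betwI[where g="\<lambda>T. T - R"])
    show "(\<lambda>U. R \<union> U) \<in> {U. U \<subseteq> A - R \<and> card U = t - card R} \<rightarrow>
        {T. R \<subseteq> T \<and> T \<subseteq> A \<and> card T = t}"
    proof
      fix U assume U: "U \<in> {U. U \<subseteq> A - R \<and> card U = t - card R}"
      then have "finite U" using assms(1) by (auto intro: finite_subset)
      then have "card (R \<union> U) = card R + card U"
        using U fR by (intro card_Un_disjoint) auto
      then show "R \<union> U \<in> {T. R \<subseteq> T \<and> T \<subseteq> A \<and> card T = t}" using U assms by auto
    qed
    show "(\<lambda>T. T - R) \<in> {T. R \<subseteq> T \<and> T \<subseteq> A \<and> card T = t} \<rightarrow>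
        {U. U \<subseteq> A - R \<and> card U = t - card R}"
      using fR by (auto simp: card_Diff_subset)
  qed auto
  then have "card {T. R \<subseteq> T \<and> T \<subseteq> A \<and> card T = t} = card {U. U \<subseteq> A - R \<and> card U = t - card R}"
    by (simp add: bij_betw_same_card)
  also have "\<dots> = card (A - R) choose (t - card R)"
    using assms(1) by (intro n_subsets) auto
  finally show ?thesis using assms(2) fR by (simp add: card_Diff_subset)
qed

context
  fixes t m l lam :: nat and S :: "nat set set"
  assumes design: "symmetric_block_design t m l lam S"
begin

lemma block_subset: "J \<in> S \<Longrightarrow> J \<subseteq> {1..m}"
  and card_block: "J \<in> S \<Longrightarrow> card J = l"
  and card_blocks: "card S = m"
  and t_subset_count: "T \<subseteq> {1..m} \<Longrightarrow> card T = t \<Longrightarrow> card {J\<in>S. T \<subseteq> J} = lam"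
  using design by (auto simp: symmetric_block_design_def block_design_def)

lemma finite_block: "J \<in> S \<Longrightarrow> finite J"
  using block_subset finite_subset by blast

lemma finite_blocks: "finite S"
proof (rule finite_subset)
  show "S \<subseteq> Pow {1..m}" using block_subset by auto
qed simp

text \<open>Counting incidences in two ways gives \<open>m * l = m * r\<close>, because there are as
  many blocks as points.\<close>

lemma replication_number:
  assumes "x \<in> {1..m}"
  shows "card {J\<in>S. x \<in> J} = l"
proof -
  obtain r where r: "\<forall>j\<in>{1..m}. card {J\<in>S. j \<in> J} = r"
    using design by (auto simp: symmetric_block_design_def block_design_def)
  have "(\<Sum>J\<in>S. card {j\<in>{1..m}. j \<in> J}) = (\<Sum>j\<in>{1..m}. r)"
    using r finite_blocks by (intro sum_multicount_gen) auto
  moreover have "{j\<in>{1..m}. j \<in> J} = J" if "J \<in> S" for J using block_subset[OF that] by auto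
  ultimately have "m * l = m * r" using card_block card_blocks by simp
  then show ?thesis using r assms by auto
qed

text \<open>Counting in two ways the pairs of a \<open>t\<close>-set \<open>T\<close> and a block
  containing \<open>T\<close>, with \<open>x\<close> and \<open>y\<close> in \<open>T\<close>, turns
  the condition on \<open>t\<close>-sets into one on pairs of points.\<close>

lemma pair_count_binomial:
  assumes "2 \<le> t" "x \<in> {1..m}" "y \<in> {1..m}" "x \<noteq> y"
  shows "card {J\<in>S. x \<in> J \<and> y \<in> J} * ((l - 2) choose (t - 2)) = lam * ((m - 2) choose (t - 2))"
proof -
  let ?T = "{T. {x, y} \<subseteq> T \<and> T \<subseteq> {1..m} \<and> card T = t}"
  let ?B = "{J\<in>S. x \<in> J \<and> y \<in> J}"
  have 2: "card {x, y} = 2" using assms by simp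
  have "card {T\<in>?T. T \<subseteq> J} = (l - 2) choose (t - 2)" if J: "J \<in> ?B" for J
  proof -
    have "{T\<in>?T. T \<subseteq> J} = {T. {x, y} \<subseteq> T \<and> T \<subseteq> J \<and> card T = t}"
      using block_subset J by blast
    then show ?thesis
      using card_subsets_between[of J "{x, y}" t] J finite_block card_block 2 assms by auto
  qed
  then have "(\<Sum>T\<in>?T. card {J\<in>?B. T \<subseteq> J}) = (\<Sum>J\<in>?B. (l - 2) choose (t - 2))"
    using finite_blocks finite_subset[of ?T "Pow {1..m}"] by (intro sum_multicount_gen) auto
  moreover have "card {J\<in>?B. T \<subseteq> J} = lam" if T: "T \<in> ?T" for T
  proof -
    have "{J\<in>?B. T \<subseteq> J} = {J\<in>S. T \<subseteq> J}" using T by auto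
    then show ?thesis using t_subset_count T by auto
  qed
  moreover have "card ?T = (m - 2) choose (t - 2)"
    using card_subsets_between[of "{1..m}" "{x, y}" t] 2 assms by simp
  ultimately show ?thesis by (simp add: mult.commute)
qed

text \<open>Since \<open>t \<le> l\<close>, the binomial factor of the pair count is positive and
  cancels, so the number of blocks through two points is a constant. Counting the pairs of a block
  through \<open>x\<close> and a second point of it determines this constant.\<close>

lemma pair_count:
  assumes "2 \<le> t" "t \<le> l" "x \<in> {1..m}" "y \<in> {1..m}" "x \<noteq> y"
  shows "card {J\<in>S. x \<in> J \<and> y \<in> J} * (m - 1) = l * (l - 1)"
proof -
  define k where "k = card {J\<in>S. x \<in> J \<and> y \<in> J}"
  have pos: "(l - 2) choose (t - 2) > 0" using assms by (simp add: zero_less_binomial)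
  have k: "card {J\<in>S. x \<in> J \<and> z \<in> J} = k" if "z \<in> {1..m} - {x}" for z
  proof -
    have z: "z \<in> {1..m}" "x \<noteq> z" using that by auto
    have "card {J\<in>S. x \<in> J \<and> z \<in> J} * ((l - 2) choose (t - 2)) = k * ((l - 2) choose (t - 2))"
      unfolding k_def pair_count_binomial[OF assms(1,3) z] pair_count_binomial[OF assms(1,3,4,5)] ..
    then show ?thesis using pos by simp
  qed
  let ?B = "{J\<in>S. x \<in> J}"
  have "(\<Sum>J\<in>?B. card {z\<in>{1..m} - {x}. z \<in> J}) = (\<Sum>z\<in>{1..m} - {x}. k)"
  proof (intro sum_multicount_gen ballI)
    fix z assume "z \<in> {1..m} - {x}"
    then show "card {J\<in>?B. z \<in> J} = k" using k[of z] by (simp add: conj_ac)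
  qed (use finite_blocks in auto)
  moreover have "card {z\<in>{1..m} - {x}. z \<in> J} = l - 1" if J: "J \<in> ?B" for J
  proof -
    have "{z\<in>{1..m} - {x}. z \<in> J} = J - {x}" using block_subset[of J] J by auto
    then show ?thesis using J card_block finite_block by simp
  qed
  ultimately show ?thesis using replication_number assms unfolding k_def by (simp add: mult.commute)
qed

text \<open>The intersection sizes of a fixed block with the others have variance zero.\<close>

lemma card_block_Int:
  assumes "2 \<le> t" "t \<le> l" "l < m" and J: "J \<in> S" and J': "J' \<in> S" "J' \<noteq> J"
  shows "card (J \<inter> J') * (m - 1) = l * (l - 1)"
proof -
  have "\<not> card J \<le> 1" using J card_block assms by simp
  then obtain x0 y0 where "x0 \<in> J" "y0 \<in> J" "x0 \<noteq> y0"
    using card_le_Suc0_iff_eq[OF finite_block[OF J]] by auto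
  define k where "k = real (card {B\<in>S. x0 \<in> B \<and> y0 \<in> B})"
  define a where "a B = real (card (J \<inter> B))" for B
  have fin: "finite J" "finite S" using J finite_block finite_blocks by auto
  have xy0: "x0 \<in> {1..m}" "y0 \<in> {1..m}" using \<open>x0 \<in> J\<close> \<open>y0 \<in> J\<close> block_subset[OF J] by auto
  have km: "k * (real m - 1) = real l * (real l - 1)"
    using arg_cong[OF pair_count[OF assms(1,2) xy0 \<open>x0 \<noteq> y0\<close>], of real] assms unfolding k_def
    by (simp add: of_nat_diff)
  have pc: "real (card {B\<in>S. x \<in> B \<and> y \<in> B}) = (if x = y then real l else k)"
    if "x \<in> J" "y \<in> J" for x y
  proof (cases "x = y")
    case False
    have "x \<in> {1..m}" "y \<in> {1..m}" using that block_subset[OF J] by auto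
    then have "card {B\<in>S. x \<in> B \<and> y \<in> B} * (m - 1) = card {B\<in>S. x0 \<in> B \<and> y0 \<in> B} * (m - 1)"
      using pair_count[OF assms(1,2) _ _ False] pair_count[OF assms(1,2) xy0 \<open>x0 \<noteq> y0\<close>] by simp
    moreover have "m - 1 > 0" using assms by simp
    ultimately have "card {B\<in>S. x \<in> B \<and> y \<in> B} = card {B\<in>S. x0 \<in> B \<and> y0 \<in> B}" by simp
    then show ?thesis using False unfolding k_def by simp
  next
    case True
    then show ?thesis using replication_number[of x] block_subset[OF J] that by auto
  qed
  have ind: "a B = (\<Sum>x\<in>J. of_bool (x \<in> B))" for B
    unfolding a_def using fin by (simp add: Int_def)
  have swap: "(\<Sum>B\<in>S. of_bool (P B)) = real (card {B\<in>S. P B})" for P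
    using fin by (simp add: Int_def)
  have sum1: "(\<Sum>B\<in>S. a B) = real l * real l"
  proof -
    have "(\<Sum>B\<in>S. a B) = (\<Sum>x\<in>J. \<Sum>B\<in>S. of_bool (x \<in> B))"
      unfolding ind by (rule sum.swap)
    also have "\<dots> = (\<Sum>x\<in>J. real l)"
      unfolding swap using replication_number block_subset[OF J] by (intro sum.cong) auto
    finally show ?thesis using card_block[OF J] by simp
  qed
  have sum2: "(\<Sum>B\<in>S. (a B)\<^sup>2) = real l * real l + real l * (real l - 1) * k"
  proof -
    have "(\<Sum>B\<in>S. (a B)\<^sup>2) = (\<Sum>B\<in>S. \<Sum>x\<in>J. \<Sum>y\<in>J. of_bool (x \<in> B \<and> y \<in> B))"
      unfolding ind power2_eq_square sum_product by (simp flip: of_bool_conj)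
    also have "\<dots> = (\<Sum>x\<in>J. \<Sum>B\<in>S. \<Sum>y\<in>J. of_bool (x \<in> B \<and> y \<in> B))" by (rule sum.swap)
    also have "\<dots> = (\<Sum>x\<in>J. \<Sum>y\<in>J. \<Sum>B\<in>S. of_bool (x \<in> B \<and> y \<in> B))"
      by (intro sum.cong refl sum.swap)
    also have "\<dots> = (\<Sum>x\<in>J. \<Sum>y\<in>J. if x = y then real l else k)"
      unfolding swap by (intro sum.cong refl pc)
    also have "\<dots> = (\<Sum>x\<in>J. \<Sum>y\<in>J. k + (if x = y then real l - k else 0))"
      by (intro sum.cong refl) auto
    also have "\<dots> = (\<Sum>x\<in>J. real l * k + (real l - k))"
      using fin card_block[OF J] by (simp add: sum.distrib)
    also have "\<dots> = real l * real l + real l * (real l - 1) * k"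
      using card_block[OF J] by (simp add: algebra_simps)
    finally show ?thesis .
  qed
  have aJ: "a J = real l" unfolding a_def using card_block[OF J] by simp
  \<comment> \<open>\<open>k\<close> is the mean intersection size. By \<open>km\<close>, the three
    terms of the expansion are 1, -2 and 1 times \<open>real l * (real l - 1) * k\<close>.\<close>
  have "(\<Sum>B\<in>S - {J}. (a B - k)\<^sup>2)
      = (\<Sum>B\<in>S - {J}. (a B)\<^sup>2) - 2 * k * (\<Sum>B\<in>S - {J}. a B) + k\<^sup>2 * (real m - 1)"
    using J fin card_blocks assms
    by (simp add: power2_diff sum.distrib sum_subtractf sum_distrib_left of_nat_diff mult_ac)
  also have "\<dots> = ((\<Sum>B\<in>S. (a B)\<^sup>2) - (a J)\<^sup>2) - 2 * k * ((\<Sum>B\<in>S. a B) - a J)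
      + k * (k * (real m - 1))"
    using J fin by (simp add: sum_diff1 power2_eq_square)
  also have "\<dots> = 0"
    unfolding sum1 sum2 aJ km by (simp add: power2_eq_square algebra_simps)
  finally have "\<forall>B\<in>S - {J}. (a B - k)\<^sup>2 = 0"
    using fin by (subst (asm) sum_nonneg_eq_0_iff) auto
  then have "a J' = k" using J' by auto
  then have "real (card (J \<inter> J')) * (real m - 1) = real l * (real l - 1)"
    using km unfolding a_def by simp
  then have "real (card (J \<inter> J') * (m - 1)) = real (l * (l - 1))"
    using assms by (simp add: of_nat_diff)
  then show ?thesis by (simp only: of_nat_eq_iff)
qed

text \<open>Adding \<open>card (J \<inter> J') \<le> l\<close> to the exact equation replaces
  \<open>m - 1\<close> by \<open>m\<close> and \<open>l * (l - 1)\<close> by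
  \<open>l * l\<close>.\<close>

lemma card_block_Int_le:
  assumes "2 \<le> t" "t \<le> l" "l < m" "J \<in> S" "J' \<in> S" "J' \<noteq> J"
  shows "card (J \<inter> J') * m \<le> l * l"
proof -
  have *: "card (J \<inter> J') * (m - 1) = l * (l - 1)" by (rule card_block_Int[OF assms])
  have "card (J \<inter> J') \<le> l"
    using card_mono[OF finite_block[OF assms(4)], of "J \<inter> J'"] card_block[OF assms(4)] by auto
  moreover have "card (J \<inter> J') * m = card (J \<inter> J') * (m - 1) + card (J \<inter> J')"
    using assms by (cases m) auto
  moreover have "l * l = l * (l - 1) + l" using assms by (cases l) auto
  ultimately show ?thesis using * by simp
qed

end

section \<open>Hermitian matrices and rank\<close>

text \<open>By multiplicativity \<open>conjugate 1\<close> is a nonzero idempotent of a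
  field.\<close>

lemma conjugate_one [simp]: "conjugate (1 :: 'a::frame_scalar) = 1"
proof -
  have "conjugate (1::'a) * conjugate 1 = conjugate 1 * 1"
    by (simp flip: conjugate_dist_mul)
  then show ?thesis by (metis conjugate_zero_iff mult_left_cancel one_neq_zero)
qed

lemma conjugate_of_nat [simp]: "conjugate (of_nat n :: 'a::frame_scalar) = of_nat n"
  by (induction n) (simp_all add: conjugate_dist_add)

lemma sum_conjugate_mult_eq_0_iff:
  fixes f :: "'b \<Rightarrow> 'a::frame_scalar"
  assumes "finite A"
  shows "(\<Sum>x\<in>A. f x * conjugate (f x)) = 0 \<longleftrightarrow> (\<forall>x\<in>A. f x = 0)"
proof -
  have "(\<Sum>x\<in>A. f x * conjugate (f x)) = 0 \<longleftrightarrow> (\<forall>x\<in>A. f x * conjugate (f x) = 0)"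
    by (rule sum_nonneg_eq_0_iff[OF assms conjugate_square_positive])
  then show ?thesis by simp
qed

lemma conj_transpose_nth [simp]: "conj_transpose A $ i $ j = conjugate (A $ j $ i)"
  by (simp add: conj_transpose_def)

lemma conj_transpose_mult:
  "conj_transpose (A ** B) = conj_transpose B ** conj_transpose A"
  by (simp add: vec_eq_iff matrix_matrix_mult_def sum_conjugate conjugate_dist_mul mult.commute)

lemma conj_transpose_sum:
  "finite I \<Longrightarrow> conj_transpose (\<Sum>i\<in>I. A i) = (\<Sum>i\<in>I. conj_transpose (A i))"
  by (simp add: vec_eq_iff sum_conjugate)

lemma matrix_mult_sum_left: "(\<Sum>i\<in>I. A i) ** B = (\<Sum>i\<in>I. A i ** B)"
  for B :: "'a::comm_ring_1^'n^'m"
  by (simp add: vec_eq_iff matrix_matrix_mult_def sum_distrib_right) (intro allI sum.swap)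

lemma matrix_mult_sum_right: "B ** (\<Sum>i\<in>I. A i) = (\<Sum>i\<in>I. B ** A i)"
  for B :: "'a::comm_ring_1^'n^'m"
  by (simp add: vec_eq_iff matrix_matrix_mult_def sum_distrib_left) (intro allI sum.swap)

lemma trace_sum: "trace (\<Sum>i\<in>I. A i) = (\<Sum>i\<in>I. trace (A i))"
  by (simp add: trace_def) (rule sum.swap)

text \<open>This trace is the squared Frobenius norm of \<open>A\<close>.\<close>

lemma trace_mult_conj_transpose_eq_0_iff:
  fixes A :: "'a::frame_scalar^'n^'m"
  shows "trace (A ** conj_transpose A) = 0 \<longleftrightarrow> A = 0"
proof -
  have "trace (A ** conj_transpose A) = (\<Sum>(i, j)\<in>UNIV. A $ i $ j * conjugate (A $ i $ j))"
    by (simp add: trace_def matrix_matrix_mult_def sum.cartesian_product)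
  also have "\<dots> = (\<Sum>p\<in>UNIV. A $ fst p $ snd p * conjugate (A $ fst p $ snd p))"
    by (simp add: case_prod_beta)
  finally show ?thesis by (simp add: sum_conjugate_mult_eq_0_iff vec_eq_iff)
qed

lemma trace_mult_conj_transpose_nonneg:
  fixes A :: "'a::frame_scalar^'n^'m"
  shows "0 \<le> trace (A ** conj_transpose A)"
  by (simp add: trace_def matrix_matrix_mult_def sum_nonneg conjugate_square_positive)

text \<open>Compressing the resolution of the identity by \<open>\<pi> j\<close> exhibits a vanishing sum of positive
  semidefinite matrices.\<close>

lemma projections_resolving_identity_orthogonal:
  fixes \<pi> :: "'i \<Rightarrow> 'a::frame_scalar^'m^'m"
  assumes fin: "finite I" and proj: "\<And>i. i \<in> I \<Longrightarrow> orthogonal_projection (\<pi> i)"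
    and sum: "(\<Sum>i\<in>I. \<pi> i) = mat 1" and ij: "i \<in> I" "j \<in> I" "i \<noteq> j"
  shows "\<pi> j ** \<pi> i = 0"
proof -
  have idem: "\<pi> k ** \<pi> k = \<pi> k" and herm: "conj_transpose (\<pi> k) = \<pi> k" if "k \<in> I" for k
    using proj[OF that] by (simp_all add: orthogonal_projection_def)
  \<comment> \<open>As a product of a matrix with its adjoint, the compression has nonnegative
    trace, and the trace vanishes only if \<open>\<pi> j ** \<pi> k\<close> does.\<close>
  have eq: "\<pi> j ** \<pi> k ** \<pi> j = (\<pi> j ** \<pi> k) ** conj_transpose (\<pi> j ** \<pi> k)" if "k \<in> I" for k
  proof -
    have "(\<pi> j ** \<pi> k) ** conj_transpose (\<pi> j ** \<pi> k) = \<pi> j ** (\<pi> k ** \<pi> k) ** \<pi> j"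
      by (simp only: conj_transpose_mult herm that ij matrix_mul_assoc)
    then show ?thesis by (simp only: idem that)
  qed
  have "\<pi> j = (\<Sum>k\<in>I. \<pi> j ** \<pi> k ** \<pi> j)"
    using idem[OF ij(2)] sum by (simp flip: matrix_mult_sum_left matrix_mult_sum_right)
  also have "\<dots> = \<pi> j + (\<Sum>k\<in>I - {j}. \<pi> j ** \<pi> k ** \<pi> j)"
    using idem[OF ij(2)] by (subst sum.remove[OF fin ij(2)]) simp
  finally have "(\<Sum>k\<in>I - {j}. \<pi> j ** \<pi> k ** \<pi> j) = 0" by simp
  then have "(\<Sum>k\<in>I - {j}. trace (\<pi> j ** \<pi> k ** \<pi> j)) = 0"
    unfolding trace_sum[symmetric] by (simp add: trace_def)
  then have "trace (\<pi> j ** \<pi> i ** \<pi> j) = 0"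
    using fin ij eq trace_mult_conj_transpose_nonneg[of "\<pi> j ** \<pi> _"]
    by (subst (asm) sum_nonneg_eq_0_iff) auto
  then show ?thesis unfolding eq[OF ij(1)] trace_mult_conj_transpose_eq_0_iff .
qed

section \<open>Matrices of rank one\<close>

definition outer_product :: "'a::times^'m \<Rightarrow> 'a^'n \<Rightarrow> 'a^'n^'m" where
  "outer_product u w = (\<chi> i j. u $ i * w $ j)"

lemma rank_le_card_spanning:
  fixes A :: "'a::field^'n^'m"
  assumes "rows A \<subseteq> vec.span W" "finite W"
  shows "rank A \<le> card W"
  unfolding row_rank_def_gen using assms by (rule vec.dim_le_card)

text \<open>The row space is spanned by a single \<open>w\<close>; the multipliers of the rows form
  \<open>u\<close>.\<close>

lemma rank_one_obtain_outer_product: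
  fixes A :: "'a::field^'n^'m"
  assumes "rank A = 1"
  obtains u w where "A = outer_product u w"
proof -
  obtain B where B: "rows A \<subseteq> vec.span B" "card B = 1"
    using assms vec.basis_exists[of "rows A"] unfolding row_rank_def_gen by metis
  then obtain w where w: "B = {w}" by (auto simp: card_Suc_eq)
  have "\<exists>c. A $ i = c *s w" for i
  proof -
    have "row i A \<in> vec.span {w}" using B w by (auto simp: rows_def)
    then show ?thesis by (auto simp: vec.span_singleton row_def)
  qed
  then obtain c where "\<And>i. A $ i = c i *s w" by metis
  then have "A = outer_product (\<chi> i. c i) w" by (simp add: vec_eq_iff outer_product_def)
  then show ?thesis by (rule that)
qed

lemma rows_outer_product: "rows (outer_product u w) \<subseteq> vec.span {w :: 'a::field^'n}"
proof -
  have "row i (outer_product u w) = u $ i *s w" for i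
    by (simp add: row_def outer_product_def vec_eq_iff)
  then show ?thesis by (auto simp: rows_def vec.span_singleton)
qed

lemma rank_outer_product:
  fixes w :: "'a::field^'n"
  assumes "outer_product u w \<noteq> 0"
  shows "rank (outer_product u w) = 1"
proof -
  have "rank (outer_product u w) \<le> 1"
    using rank_le_card_spanning[OF rows_outer_product] by fastforce
  moreover have "rank (outer_product u w) \<noteq> 0"
  proof
    assume "rank (outer_product u w) = 0"
    then have "rows (outer_product u w) \<subseteq> {0}"
      unfolding row_rank_def_gen by simp
    then have "row i (outer_product u w) = 0" for i by (auto simp: rows_def)
    then show False using assms by (simp add: row_def vec_eq_iff)
  qed
  ultimately show ?thesis by simp
qed

text \<open>Squaring the outer product of \<open>u\<close> and \<open>w\<close> multiplies it by
  their bilinear pairing \<open>c\<close>. Idempotence forces \<open>c = 1\<close>, and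
  \<open>c\<close> is also the trace.\<close>

lemma trace_rank_one_idempotent:
  fixes A :: "'a::field^'m^'m"
  assumes "A ** A = A" "rank A = 1"
  shows "trace A = 1"
proof -
  obtain u w where A: "A = outer_product u w" using rank_one_obtain_outer_product assms(2) .
  define c where "c = (\<Sum>k\<in>UNIV. w $ k * u $ k)"
  have sq: "(A ** A) $ i $ j = c * A $ i $ j" for i j
    by (simp add: A outer_product_def matrix_matrix_mult_def vec_eq_iff c_def sum_distrib_left
        sum_distrib_right mult_ac)
  have "A \<noteq> 0"
  proof
    assume "A = 0"
    then have "rows A \<subseteq> vec.span {}" by (auto simp: rows_def row_def vec_eq_iff)
    then show False using rank_le_card_spanning[of A "{}"] assms by simp
  qed
  then obtain i j where "A $ i $ j \<noteq> 0" by (auto simp: vec_eq_iff)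
  then have "c = 1" using sq[of i j] unfolding assms(1) by simp
  then show ?thesis by (simp add: c_def A trace_def outer_product_def mult.commute)
qed

lemma rank_sum_rank_one_le:
  fixes A :: "'i \<Rightarrow> 'a::field^'n^'m"
  assumes "finite I" "\<And>i. i \<in> I \<Longrightarrow> rank (A i) = 1"
  shows "rank (\<Sum>i\<in>I. A i) \<le> card I"
proof -
  have "\<exists>w. rows (A i) \<subseteq> vec.span {w}" if "i \<in> I" for i
    using rank_one_obtain_outer_product[OF assms(2)[OF that]] rows_outer_product by metis
  then obtain w where w: "\<And>i. i \<in> I \<Longrightarrow> rows (A i) \<subseteq> vec.span {w i}" by metis
  have "row r (\<Sum>i\<in>I. A i) \<in> vec.span (w ` I)" for r
  proof -
    have "row r (\<Sum>i\<in>I. A i) = (\<Sum>i\<in>I. row r (A i))" by (simp add: row_def vec_eq_iff)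
    moreover have "row r (A i) \<in> vec.span (w ` I)" if "i \<in> I" for i
      using w[OF that] vec.span_mono[of "{w i}" "w ` I"] that by (auto simp: rows_def)
    ultimately show ?thesis by (simp add: vec.span_sum)
  qed
  then have "rank (\<Sum>i\<in>I. A i) \<le> card (w ` I)"
    using assms(1) by (intro rank_le_card_spanning) (auto simp: rows_def)
  also have "\<dots> \<le> card I" using assms(1) by (rule card_image_le)
  finally show ?thesis .
qed

text \<open>The rows of \<open>A\<close> and \<open>B\<close> together span every row of the
  identity. This bounds the rank of a block projection from below, through its complement.\<close>

lemma rank_add_ge:
  fixes A B :: "'a::field^'m^'m"
  assumes "A + B = mat 1"
  shows "CARD('m) \<le> rank A + rank B"
proof -
  obtain V where V: "finite V" "rows A \<subseteq> vec.span V" "card V = rank A"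
    using vec.basis_exists[of "rows A"] vec.finiteI_independent unfolding row_rank_def_gen by metis
  obtain W where W: "finite W" "rows B \<subseteq> vec.span W" "card W = rank B"
    using vec.basis_exists[of "rows B"] vec.finiteI_independent unfolding row_rank_def_gen by metis
  have "cart_basis \<subseteq> vec.span (V \<union> W)"
  proof
    fix v :: "'a^'m" assume "v \<in> cart_basis"
    then obtain i where i: "v = axis i 1" by (auto simp: cart_basis_def)
    then have "v = row i (mat 1)" by (simp add: row_def mat_def axis_def vec_eq_iff)
    then have "v = row i A + row i B"
      by (simp add: row_def vec_eq_iff flip: assms)
    moreover have "row i A \<in> vec.span (V \<union> W)" "row i B \<in> vec.span (V \<union> W)"
      using V(2) W(2) vec.span_mono[of V "V \<union> W"] vec.span_mono[of W "V \<union> W"]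
      by (auto simp: rows_def)
    ultimately show "v \<in> vec.span (V \<union> W)" by (simp add: vec.span_add)
  qed
  then have "vec.span (cart_basis :: ('a^'m) set) \<subseteq> vec.span (V \<union> W)"
    by (intro vec.span_minimal vec.subspace_span)
  then have "vec.dim (UNIV :: ('a^'m) set) \<le> card (V \<union> W)"
    using V(1) W(1) by (intro vec.dim_le_card) (auto simp: span_cart_basis)
  then show ?thesis using card_Un_le[of V W] V W by (simp only: vec_dim_card)
qed

lemma positive_definite_mat_of_nat:
  assumes "c > 0"
  shows "positive_definite (mat (of_nat c) :: 'a::frame_scalar^'m^'m)"
proof -
  \<comment> \<open>The multiple is built up by repeated addition, so that only additive
    monotonicity of the order is used.\<close>
  have nonneg: "0 \<le> (of_nat n * (x * conjugate x) :: 'a)" for n x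
    by (induction n) (simp_all add: conjugate_square_positive add_nonneg_nonneg distrib_right)
  have "0 < (\<Sum>i\<in>UNIV. conjugate (x $ i) * (mat (of_nat c) *v x) $ i)" if "x \<noteq> 0" for x :: "'a^'m"
  proof -
    have eq: "conjugate (x $ i) * (mat (of_nat c) *v x) $ i = of_nat c * (x $ i * conjugate (x $ i))" for i
      by (simp add: matrix_vector_mult_def mat_def if_distrib[of "\<lambda>y. y * _"] cong: if_cong)
    have "(\<Sum>i\<in>UNIV. of_nat c * (x $ i * conjugate (x $ i))) \<noteq> 0"
      using that assms sum_conjugate_mult_eq_0_iff[of UNIV "\<lambda>i. x $ i"]
      by (simp add: vec_eq_iff flip: sum_distrib_left)
    then show ?thesis unfolding eq using nonneg by (simp add: order_less_le sum_nonneg)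
  qed
  moreover have "conj_transpose (mat (of_nat c) :: 'a^'m^'m) = mat (of_nat c)"
    by (simp add: vec_eq_iff mat_def)
  ultimately show ?thesis by (simp add: positive_definite_def)
qed

section \<open>Block projections\<close>

context
  fixes t l lam K :: nat and S :: "nat set set"
    and B :: "nat \<Rightarrow> nat \<Rightarrow> 'a::frame_scalar^'m^'m"
  assumes l: "l < CARD('m)" and t: "2 \<le> t" "t \<le> l"
    and design: "symmetric_block_design t CARD('m) l lam S"
    and mub: "mutually_unbiased_bases K B"
begin

lemma basis_projection: "orthogonal_projection (B k j)" "rank (B k j) = 1"
  if "k \<in> {1..K}" "j \<in> {1..CARD('m)}"
  using mub that by (auto simp: mutually_unbiased_bases_def fusion_frame_def packing_def)

lemma basis_resolves_identity: "k \<in> {1..K} \<Longrightarrow> (\<Sum>j\<in>{1..CARD('m)}. B k j) = mat 1"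
  using mub by (auto simp: mutually_unbiased_bases_def tight_def)

lemma basis_mult:
  assumes "k \<in> {1..K}" "i \<in> {1..CARD('m)}" "j \<in> {1..CARD('m)}"
  shows "B k i ** B k j = (if i = j then B k i else 0)"
proof (cases "i = j")
  case True
  then show ?thesis using basis_projection[OF assms(1,2)] by (simp add: orthogonal_projection_def)
next
  case False
  then show ?thesis
    using projections_resolving_identity_orthogonal[of "{1..CARD('m)}" "B k" j i]
      basis_projection basis_resolves_identity assms by simp
qed

lemma trace_basis_mult_same:
  assumes "k \<in> {1..K}" "i \<in> {1..CARD('m)}" "j \<in> {1..CARD('m)}"
  shows "trace (B k i ** B k j) = of_bool (i = j)"
  using basis_mult[OF assms] basis_projection[OF assms(1,2)] trace_rank_one_idempotent[of "B k i"]
  by (auto simp: orthogonal_projection_def trace_def)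

lemma trace_basis_mult_different:
  assumes "k \<in> {1..K}" "k' \<in> {1..K}" "k \<noteq> k'" "i \<in> {1..CARD('m)}" "j \<in> {1..CARD('m)}"
  shows "trace (B k i ** B k' j) = 1 / of_nat CARD('m)"
  using mub assms by (auto simp: mutually_unbiased_bases_def)

lemma trace_block_projection_mult:
  "trace (block_projection B (k, J) ** block_projection B (k', J'))
     = (\<Sum>i\<in>J. \<Sum>j\<in>J'. trace (B k i ** B k' j))"
  by (simp add: block_projection_def matrix_mult_sum_left matrix_mult_sum_right trace_sum)
     (rule sum.swap)

lemmas block = block_subset[OF design] card_block[OF design] finite_block[OF design]

lemma trace_block_projection_same:
  assumes "k \<in> {1..K}" "J \<in> S" "J' \<in> S"
  shows "trace (block_projection B (k, J) ** block_projection B (k, J')) = of_nat (card (J \<inter> J'))"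
proof -
  have "trace (block_projection B (k, J) ** block_projection B (k, J'))
      = (\<Sum>i\<in>J. \<Sum>j\<in>J'. of_bool (i = j))"
    unfolding trace_block_projection_mult
    using block(1)[OF assms(2)] block(1)[OF assms(3)] assms(1)
    by (intro sum.cong refl trace_basis_mult_same) auto
  also have "\<dots> = (\<Sum>i\<in>J. of_bool (i \<in> J'))"
    using block(3)[OF assms(3)] by (intro sum.cong refl) (simp add: of_bool_def)
  finally show ?thesis using block(3)[OF assms(2)] by (simp add: Int_def)
qed

lemma trace_block_projection_different:
  assumes "k \<in> {1..K}" "k' \<in> {1..K}" "k \<noteq> k'" "J \<in> S" "J' \<in> S"
  shows "trace (block_projection B (k, J) ** block_projection B (k', J'))
    = of_real ((real l)\<^sup>2 / real CARD('m))"
proof -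
  have "trace (block_projection B (k, J) ** block_projection B (k', J'))
      = (\<Sum>i\<in>J. \<Sum>j\<in>J'. 1 / of_nat CARD('m))"
    unfolding trace_block_projection_mult
    using block(1)[OF assms(4)] block(1)[OF assms(5)] assms(1-3)
    by (intro sum.cong refl trace_basis_mult_different) auto
  then show ?thesis using block(2)[OF assms(4)] block(2)[OF assms(5)] by (simp add: power2_eq_square)
qed

lemma orthogonal_projection_block_projection:
  assumes "k \<in> {1..K}" "J \<in> S"
  shows "orthogonal_projection (block_projection B (k, J))"
proof -
  have J: "j \<in> {1..CARD('m)}" if "j \<in> J" for j using block(1)[OF assms(2)] that by auto
  have "block_projection B (k, J) ** block_projection B (k, J) = (\<Sum>i\<in>J. \<Sum>j\<in>J. B k i ** B k j)"
    by (simp add: block_projection_def matrix_mult_sum_left matrix_mult_sum_right) (rule sum.swap)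
  also have "\<dots> = (\<Sum>i\<in>J. \<Sum>j\<in>J. if i = j then B k i else 0)"
    using J assms(1) by (intro sum.cong refl basis_mult) auto
  also have "\<dots> = block_projection B (k, J)"
    using block(3)[OF assms(2)] by (simp add: block_projection_def)
  moreover have "conj_transpose (block_projection B (k, J)) = block_projection B (k, J)"
    using basis_projection(1) J assms block(3)[OF assms(2)]
    by (simp add: block_projection_def conj_transpose_sum orthogonal_projection_def)
  ultimately show ?thesis by (simp add: orthogonal_projection_def)
qed

text \<open>The ranks of the block sum and of the complementary sum are at most \<open>l\<close> and
  \<open>CARD('m) - l\<close>, and they add up to at least \<open>CARD('m)\<close>; hence both
  bounds are attained.\<close>

lemma rank_block_projection:
  assumes "k \<in> {1..K}" "J \<in> S"
  shows "rank (block_projection B (k, J)) = l"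
proof -
  let ?J = "{1..CARD('m)} - J"
  have J: "J \<subseteq> {1..CARD('m)}" by (rule block(1)[OF assms(2)])
  have "rank (\<Sum>j\<in>J. B k j) \<le> card J"
    using basis_projection(2) J assms(1) block(3)[OF assms(2)] by (intro rank_sum_rank_one_le) auto
  moreover have "rank (\<Sum>j\<in>?J. B k j) \<le> card ?J"
    using basis_projection(2) assms(1) by (intro rank_sum_rank_one_le) auto
  moreover have "(\<Sum>j\<in>J. B k j) + (\<Sum>j\<in>?J. B k j) = mat 1"
    using J basis_resolves_identity[OF assms(1)] by (simp add: sum.subset_diff[of J] add.commute)
  then have "CARD('m) \<le> rank (\<Sum>j\<in>J. B k j) + rank (\<Sum>j\<in>?J. B k j)" by (rule rank_add_ge)
  moreover have "card ?J = CARD('m) - l"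
    using J block(2,3)[OF assms(2)] by (simp add: card_Diff_subset)
  ultimately show ?thesis using l block(2)[OF assms(2)] by (simp add: block_projection_def)
qed

text \<open>Within one basis each projection occurs once for every block through its point, that is
  \<open>l\<close> times, so every basis contributes \<open>l\<close> times the identity.\<close>

lemma sum_block_projections:
  "(\<Sum>p\<in>{1..K} \<times> S. block_projection B p) = mat (of_nat (K * l))"
proof -
  have "(\<Sum>J\<in>S. block_projection B (k, J)) = mat (of_nat l)" if k: "k \<in> {1..K}" for k
  proof -
    have "(\<Sum>J\<in>S. block_projection B (k, J))
        = (\<Sum>J\<in>S. \<Sum>j\<in>{1..CARD('m)}. if j \<in> J then B k j else 0)"
      unfolding block_projection_def
      using block(1) by (auto intro!: sum.cong simp: Int_absorb1 simp flip: sum.inter_restrict)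
    also have "\<dots> = (\<Sum>j\<in>{1..CARD('m)}. \<Sum>J\<in>S. if j \<in> J then B k j else 0)"
      by (rule sum.swap)
    \<comment> \<open>On matrices \<open>*\<close> is the entrywise product and
      \<open>of_nat l\<close> has all entries equal to \<open>l\<close>, so this is a scalar
      multiple.\<close>
    also have "\<dots> = (\<Sum>j\<in>{1..CARD('m)}. of_nat l * B k j)"
    proof (intro sum.cong refl)
      fix j assume "j \<in> {1..CARD('m)}"
      then have "card {J\<in>S. j \<in> J} = l" by (rule replication_number[OF design])
      then show "(\<Sum>J\<in>S. if j \<in> J then B k j else 0) = of_nat l * B k j"
        using finite_blocks[OF design] by (simp add: sum.If_cases Int_def)
    qed
    also have "\<dots> = of_nat l * mat 1"
      using basis_resolves_identity[OF k] by (simp flip: sum_distrib_left)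
    also have "of_nat l * mat 1 = (mat (of_nat l) :: 'a^'m^'m)"
      by (simp add: vec_eq_iff mat_def of_nat_index)
    finally show ?thesis .
  qed
  then have "(\<Sum>p\<in>{1..K} \<times> S. block_projection B p) = (\<Sum>k\<in>{1..K}. mat (of_nat l))"
    unfolding sum.cartesian_product' by (intro sum.cong refl)
  then show ?thesis by (simp add: vec_eq_iff mat_def of_nat_index)
qed

lemma coherence_block_projections:
  assumes "2 \<le> K"
  shows "coherence ({1..K} \<times> S) (block_projection B) = (real l)\<^sup>2 / real CARD('m)"
  unfolding coherence_def
proof (rule Max_eqI)
  let ?I = "{1..K} \<times> S" and ?P = "block_projection B"
  let ?C = "{c. \<exists>j\<in>?I. \<exists>j'\<in>?I. j \<noteq> j' \<and> trace (?P j ** ?P j') = of_real c}"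
  have fin: "finite ?I" using finite_blocks[OF design] by simp
  \<comment> \<open>\<open>Max\<close> needs a finite set: \<open>of_real\<close> embeds the
    candidate values injectively into the finitely many traces.\<close>
  have "of_real ` ?C \<subseteq> (\<lambda>(j, j'). trace (?P j ** ?P j')) ` (?I \<times> ?I)" by force
  then have "finite (of_real ` ?C :: 'a set)" by (rule finite_subset) (use fin in simp)
  then show "finite ?C" by (rule finite_imageD) (simp add: inj_on_def)
  have "card S > 0" using card_blocks[OF design] by simp
  then obtain J where J: "J \<in> S" by (metis card_gt_0_iff ex_in_conv)
  \<comment> \<open>The maximum is attained by one block taken in two different bases, which is
    where \<open>2 \<le> K\<close> enters.\<close>
  have "trace (?P (1::nat, J) ** ?P (2::nat, J)) = of_real ((real l)\<^sup>2 / real CARD('m))"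
    using assms J by (intro trace_block_projection_different) auto
  moreover have "(1::nat, J) \<in> ?I" "(2::nat, J) \<in> ?I" "(1::nat, J) \<noteq> (2, J)" using assms J by auto
  ultimately show "(real l)\<^sup>2 / real CARD('m) \<in> ?C" by blast
next
  fix c assume "c \<in> {c. \<exists>j\<in>{1..K} \<times> S. \<exists>j'\<in>{1..K} \<times> S. j \<noteq> j' \<and>
    trace (block_projection B j ** block_projection B j') = of_real c}"
  then obtain j j' where jj: "j \<in> {1..K} \<times> S" "j' \<in> {1..K} \<times> S" "j \<noteq> j'"
    "trace (block_projection B j ** block_projection B j') = of_real c" by blast
  obtain k J k' J' where "j = (k, J)" "j' = (k', J')" by (metis surj_pair)
  with jj have p: "k \<in> {1..K}" "J \<in> S" "k' \<in> {1..K}" "J' \<in> S" "(k, J) \<noteq> (k', J')"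
    and c: "trace (block_projection B (k, J) ** block_projection B (k', J')) = of_real c" by simp_all
  show "c \<le> (real l)\<^sup>2 / real CARD('m)"
  proof (cases "k = k'")
    case True
    then have "of_real c = (of_real (real (card (J \<inter> J'))) :: 'a)"
      using trace_block_projection_same p c by simp
    then have "c = real (card (J \<inter> J'))" by (simp only: of_real_eq_iff)
    moreover have "card (J \<inter> J') * CARD('m) \<le> l * l"
      using p True by (intro card_block_Int_le[OF design t l]) auto
    then have "real (card (J \<inter> J')) * real CARD('m) \<le> (real l)\<^sup>2"
      by (simp add: power2_eq_square flip: of_nat_mult)
    ultimately show ?thesis by (simp add: pos_le_divide_eq)
  next
    case False
    then have "of_real c = (of_real ((real l)\<^sup>2 / real CARD('m)) :: 'a)"
      using trace_block_projection_different p c by simp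
    then show ?thesis by (simp only: of_real_eq_iff)
  qed
qed

lemma tight_block_projections:
  "tight (CARD('m) * K) l ({1..K} \<times> S) (block_projection B)"
  unfolding tight_def sum_block_projections by simp

lemma OGFF_block_projections:
  assumes "2 \<le> K" "real (CARD('m) * K) > herm_dim TYPE('a) CARD('m) + 1"
  shows "OGFF (CARD('m) * K) l ({1..K} \<times> S) (block_projection B)"
proof -
  have "packing (CARD('m) * K) l ({1..K} \<times> S) (block_projection B)"
    unfolding packing_def
    using finite_blocks[OF design] card_blocks[OF design] rank_block_projection
      orthogonal_projection_block_projection by (auto simp: card_cartesian_product)
  moreover have "positive_definite (\<Sum>p\<in>{1..K} \<times> S. block_projection B p)"
    unfolding sum_block_projections using assms t by (intro positive_definite_mat_of_nat) simp
  ultimately show ?thesis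
    using assms coherence_block_projections by (simp add: OGFF_def fusion_frame_def)
qed

end

section \<open>Unbiased bases from quadratic functions\<close>

text \<open>The vectors of the \<open>k\<close>-th basis keep their common squared length
  \<open>N k\<close>. Only the projections matter, and dividing these by \<open>N k\<close> avoids
  square roots in the scalar field.\<close>

lemma mutually_unbiased_bases_of_vectors:
  fixes w :: "nat \<Rightarrow> nat \<Rightarrow> 'm::finite \<Rightarrow> 'a::frame_scalar" and N :: "nat \<Rightarrow> nat"
  assumes N: "\<And>k. k \<in> {1..K} \<Longrightarrow> N k > 0"
    and orth: "\<And>k i j. k \<in> {1..K} \<Longrightarrow> i \<in> {1..CARD('m)} \<Longrightarrow> j \<in> {1..CARD('m)} \<Longrightarrow>
      (\<Sum>x\<in>UNIV. w k i x * conjugate (w k j x)) = (if i = j then of_nat (N k) else 0)"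
    and cross: "\<And>s k i j. s \<in> {1..K} \<Longrightarrow> k \<in> {1..K} \<Longrightarrow> s \<noteq> k \<Longrightarrow>
      i \<in> {1..CARD('m)} \<Longrightarrow> j \<in> {1..CARD('m)} \<Longrightarrow>
      (\<Sum>x\<in>UNIV. w s i x * conjugate (w k j x)) * conjugate (\<Sum>x\<in>UNIV. w s i x * conjugate (w k j x))
        * of_nat CARD('m) = of_nat (N s) * of_nat (N k)"
  shows "\<exists>B :: nat \<Rightarrow> nat \<Rightarrow> 'a^'m^'m. mutually_unbiased_bases K B"
proof
  define B :: "nat \<Rightarrow> nat \<Rightarrow> 'a^'m^'m" where
    "B k j = outer_product (\<chi> a. w k j a / of_nat (N k)) (\<chi> a. conjugate (w k j a))" for k j
  have B: "B k j $ a $ b = w k j a * conjugate (w k j b) / of_nat (N k)" for k j a b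
    by (simp add: B_def outer_product_def)
  have conj_div: "conjugate (x / of_nat n) = conjugate x / (of_nat n :: 'a)" for x n
  proof (cases "n = 0")
    case False
    have "conjugate (x / of_nat n) * of_nat n = conjugate (x / of_nat n * (of_nat n :: 'a))"
      by (simp only: conjugate_dist_mul conjugate_of_nat)
    also have "\<dots> = conjugate x" using False by simp
    finally show ?thesis using False by (simp add: eq_divide_eq)
  qed simp
  have trace_mult: "trace (B s i ** B k j) =
      (\<Sum>x\<in>UNIV. w s i x * conjugate (w k j x)) * conjugate (\<Sum>x\<in>UNIV. w s i x * conjugate (w k j x))
        / (of_nat (N s) * of_nat (N k))" for s i k j
    by (simp add: trace_def matrix_matrix_mult_def B sum_product sum_conjugate conjugate_dist_mul
        sum_divide_distrib mult_ac)
      (rule sum.swap)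
  have proj: "orthogonal_projection (B k j)" "rank (B k j) = 1"
    if k: "k \<in> {1..K}" and j: "j \<in> {1..CARD('m)}" for k j
  proof -
    have Nk: "(of_nat (N k) :: 'a) \<noteq> 0" using N[OF k] by simp
    have "(B k j ** B k j) $ a $ b
        = w k j a * conjugate (w k j b) * (\<Sum>x\<in>UNIV. w k j x * conjugate (w k j x)) / (of_nat (N k))\<^sup>2"
      for a b
      by (simp add: matrix_matrix_mult_def B sum_distrib_left sum_divide_distrib power2_eq_square mult_ac)
    then have "B k j ** B k j = B k j"
      using orth[OF k j j] Nk by (simp add: vec_eq_iff B power2_eq_square)
    moreover have "conj_transpose (B k j) = B k j"
      by (simp add: vec_eq_iff B conj_div conjugate_dist_mul mult.commute)
    ultimately show "orthogonal_projection (B k j)" by (simp add: orthogonal_projection_def)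
    have "trace (B k j) = 1"
      using orth[OF k j j] Nk by (simp add: trace_def B flip: sum_divide_distrib)
    then have "B k j \<noteq> 0" by (auto simp: trace_def)
    then show "rank (B k j) = 1" unfolding B_def by (rule rank_outer_product)
  qed
  have resolve: "(\<Sum>j\<in>{1..CARD('m)}. B k j) = mat 1" if k: "k \<in> {1..K}" for k
  proof -
    obtain h :: "'m \<Rightarrow> nat" where h: "bij_betw h UNIV {1..CARD('m)}"
      using ex_bij_betw_finite_nat[of "UNIV :: 'm set"]
      by (metis bij_betw_iff_card card_atLeastAtMost diff_Suc_1 finite finite_atLeastAtMost)
    have hmem: "h b \<in> {1..CARD('m)}" for b using bij_betwE[OF h] by auto
    have hinj: "h b = h c \<longleftrightarrow> b = c" for b c using h by (auto simp: bij_betw_def inj_on_def)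
    have Nk: "(of_nat (N k) :: 'a) \<noteq> 0" using N[OF k] by simp
    \<comment> \<open>The orthogonality relations say \<open>?V ** ?U = mat 1\<close>. For square
      matrices the reversed product is then the identity too, and that is the resolution of the
      identity.\<close>
    let ?U = "\<chi> a b. w k (h b) a :: 'a^'m^'m"
    let ?V = "\<chi> a b. conjugate (w k (h a) b) / of_nat (N k) :: 'a^'m^'m"
    have "(?V ** ?U) $ a $ b = mat 1 $ a $ b" for a b
    proof -
      have "(?V ** ?U) $ a $ b = (\<Sum>x\<in>UNIV. w k (h b) x * conjugate (w k (h a) x)) / of_nat (N k)"
        by (simp add: matrix_matrix_mult_def sum_divide_distrib mult_ac)
      then show ?thesis using orth[OF k hmem hmem, of b a] Nk by (auto simp: mat_def hinj)
    qed
    then have "?V ** ?U = mat 1" by (simp add: vec_eq_iff)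
    then have UV: "?U ** ?V = mat 1" by (simp add: matrix_left_right_inverse)
    have "(\<Sum>j\<in>{1..CARD('m)}. B k j) $ a $ b = (?U ** ?V) $ a $ b" for a b
      using sum.reindex_bij_betw[OF h, of "\<lambda>j. B k j $ a $ b"]
      by (simp add: matrix_matrix_mult_def B)
    then show ?thesis unfolding UV by (simp add: vec_eq_iff)
  qed
  show "mutually_unbiased_bases K B"
    unfolding mutually_unbiased_bases_def
  proof (intro conjI ballI impI)
    fix k assume k: "k \<in> {1..K}"
    show "tight CARD('m) 1 {1..CARD('m)} (B k)" using resolve[OF k] by (simp add: tight_def)
    have "packing CARD('m) 1 {1..CARD('m)} (B k)" using proj[OF k] by (simp add: packing_def)
    then show "fusion_frame CARD('m) 1 {1..CARD('m)} (B k)"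
      unfolding fusion_frame_def resolve[OF k]
      using positive_definite_mat_of_nat[of 1, where 'm='m and 'a='a] by simp
  next
    fix s k i j
    assume "s \<in> {1..K}" "k \<in> {1..K}" "s \<noteq> k" "i \<in> {1..CARD('m)}" "j \<in> {1..CARD('m)}"
    then show "trace (B s i ** B k j) = 1 / of_nat CARD('m)"
      unfolding trace_mult using cross[of s k i j] N[of s] N[of k]
      by (simp add: field_simps)
  qed
qed

section \<open>Characters and Gauss sums on a finite abelian group\<close>

locale finite_additive_subgroup =
  fixes G :: "'g::ab_group_add set"
  assumes finite_G: "finite G" and zero_mem: "0 \<in> G"
    and diff_mem: "x \<in> G \<Longrightarrow> y \<in> G \<Longrightarrow> x - y \<in> G"
begin

lemma uminus_mem: "x \<in> G \<Longrightarrow> - x \<in> G"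
  using diff_mem[OF zero_mem] by simp

lemma add_mem: "x \<in> G \<Longrightarrow> y \<in> G \<Longrightarrow> x + y \<in> G"
  using diff_mem[OF _ uminus_mem] by simp

lemma sum_translate:
  assumes "v \<in> G"
  shows "(\<Sum>x\<in>G. F (v + x)) = (\<Sum>x\<in>G. F x)"
proof (rule sum.reindex_bij_betw[OF bij_betwI[where g = "\<lambda>x. - v + x"]])
  show "(+) v \<in> G \<rightarrow> G" "(+) (- v) \<in> G \<rightarrow> G" using assms add_mem uminus_mem by blast+
qed (simp_all add: algebra_simps)

text \<open>Translation by \<open>v\<close> preserves the sum and also multiplies it by
  \<open>\<psi> v\<close>, which is not 1.\<close>

lemma sum_character_eq_0:
  fixes \<psi> :: "'g \<Rightarrow> 'a::idom"
  assumes "\<And>x y. x \<in> G \<Longrightarrow> y \<in> G \<Longrightarrow> \<psi> (x + y) = \<psi> x * \<psi> y" and "v \<in> G" "\<psi> v \<noteq> 1"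
  shows "(\<Sum>x\<in>G. \<psi> x) = 0"
proof -
  have "(\<Sum>x\<in>G. \<psi> x) = (\<Sum>x\<in>G. \<psi> (v + x))" by (rule sum_translate[OF assms(2), symmetric])
  also have "\<dots> = \<psi> v * (\<Sum>x\<in>G. \<psi> x)" using assms by (simp add: sum_distrib_left)
  finally show ?thesis using assms(3) by simp
qed

text \<open>The square modulus of a Gauss sum: after the substitution \<open>x = v + y\<close>, the sum over \<open>y\<close> is
  a character sum, which vanishes unless \<open>v = 0\<close>.\<close>

lemma gauss_sum_mult_conjugate:
  fixes h :: "'g \<Rightarrow> 'a::frame_scalar" and \<gamma> :: "'g \<Rightarrow> 'g \<Rightarrow> 'a"
  assumes quad: "\<And>x y. x \<in> G \<Longrightarrow> y \<in> G \<Longrightarrow> h (x + y) = h x * h y * \<gamma> x y"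
    and unit: "\<And>x. x \<in> G \<Longrightarrow> h x * conjugate (h x) = 1"
    and add: "\<And>x y z. x \<in> G \<Longrightarrow> y \<in> G \<Longrightarrow> z \<in> G \<Longrightarrow> \<gamma> x (y + z) = \<gamma> x y * \<gamma> x z"
    and nondeg: "\<And>x. x \<in> G \<Longrightarrow> x \<noteq> 0 \<Longrightarrow> \<exists>y\<in>G. \<gamma> x y \<noteq> 1"
  shows "(\<Sum>x\<in>G. h x) * conjugate (\<Sum>x\<in>G. h x) = of_nat (card G)"
proof -
  have nz: "h x \<noteq> 0" if "x \<in> G" for x using unit[OF that] by auto
  \<comment> \<open>The normalisation \<open>h 0 = 1\<close> is derived: additivity makes
    \<open>\<gamma> 0 0\<close> idempotent, and it is nonzero by this equation.\<close>
  have zero: "h 0 * \<gamma> 0 y = 1" if y: "y \<in> G" for y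
    using quad[OF zero_mem y] nz[OF y] by simp
  have "\<gamma> 0 0 = 1"
    using add[OF zero_mem zero_mem zero_mem] zero[OF zero_mem] by auto
  with zero zero_mem have h0: "h 0 = 1" by force
  then have \<gamma>0: "\<gamma> 0 y = 1" if "y \<in> G" for y using zero[OF that] by simp
  have "(\<Sum>x\<in>G. h x) * conjugate (\<Sum>x\<in>G. h x) = (\<Sum>y\<in>G. (\<Sum>x\<in>G. h x) * conjugate (h y))"
    by (simp add: sum_conjugate finite_G sum_distrib_left)
  also have "\<dots> = (\<Sum>y\<in>G. \<Sum>v\<in>G. h (y + v) * conjugate (h y))"
  proof (intro sum.cong refl)
    fix y assume "y \<in> G"
    then show "(\<Sum>x\<in>G. h x) * conjugate (h y) = (\<Sum>v\<in>G. h (y + v) * conjugate (h y))"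
      using sum_translate[of y "\<lambda>z. h z * conjugate (h y)"] by (simp add: sum_distrib_right)
  qed
  also have "\<dots> = (\<Sum>y\<in>G. \<Sum>v\<in>G. h v * \<gamma> v y)"
  proof (intro sum.cong refl)
    fix y v assume y: "y \<in> G" and v: "v \<in> G"
    have "h (y + v) * conjugate (h y) = h v * \<gamma> v y * (h y * conjugate (h y))"
      using quad[OF v y] by (simp add: add.commute mult_ac)
    then show "h (y + v) * conjugate (h y) = h v * \<gamma> v y" using unit[OF y] by simp
  qed
  also have "\<dots> = (\<Sum>v\<in>G. h v * (\<Sum>y\<in>G. \<gamma> v y))"
    by (subst sum.swap) (simp add: sum_distrib_left)
  also have "\<dots> = (\<Sum>v\<in>G. if v = 0 then of_nat (card G) else 0)"
  proof (intro sum.cong refl)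
    fix v assume v: "v \<in> G"
    show "h v * (\<Sum>y\<in>G. \<gamma> v y) = (if v = 0 then of_nat (card G) else 0)"
    proof (cases "v = 0")
      case False
      with nondeg[OF v] obtain y where "y \<in> G" "\<gamma> v y \<noteq> 1" by auto
      then have "(\<Sum>y\<in>G. \<gamma> v y) = 0" using add[OF v] by (intro sum_character_eq_0) auto
      then show ?thesis using False by simp
    qed (simp add: h0 \<gamma>0)
  qed
  also have "\<dots> = of_nat (card G)" using zero_mem finite_G by simp
  finally show ?thesis .
qed

text \<open>Multiplying \<open>f s\<close> by a character does not change its polarisation. Hence
  the inner product of vectors from the bases of \<open>s\<close> and \<open>t\<close> is a Gauss
  sum with bicharacter \<open>\<beta> s / \<beta> t\<close>, written with a conjugate instead of a
  quotient.\<close>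

lemma mutually_unbiased_bases_of_quadratic_functions:
  fixes e :: "'g \<Rightarrow> 'g \<Rightarrow> 'a::frame_scalar" and f :: "'s \<Rightarrow> 'g \<Rightarrow> 'a"
    and \<beta> :: "'s \<Rightarrow> 'g \<Rightarrow> 'g \<Rightarrow> 'a"
  assumes card_G: "card G = CARD('m::finite)" and \<Sigma>: "finite \<Sigma>" "card \<Sigma> = n"
    and e_add_left: "\<And>x y z. x \<in> G \<Longrightarrow> y \<in> G \<Longrightarrow> z \<in> G \<Longrightarrow> e (x + y) z = e x z * e y z"
    and e_add_right: "\<And>x y z. x \<in> G \<Longrightarrow> y \<in> G \<Longrightarrow> z \<in> G \<Longrightarrow> e x (y + z) = e x y * e x z"
    and e_unit: "\<And>x y. x \<in> G \<Longrightarrow> y \<in> G \<Longrightarrow> e x y * conjugate (e x y) = 1"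
    and e_nondeg: "\<And>x. x \<in> G \<Longrightarrow> x \<noteq> 0 \<Longrightarrow> \<exists>y\<in>G. e x y \<noteq> 1"
    and f_quad: "\<And>s x y. s \<in> \<Sigma> \<Longrightarrow> x \<in> G \<Longrightarrow> y \<in> G \<Longrightarrow> f s (x + y) = f s x * f s y * \<beta> s x y"
    and f_unit: "\<And>s x. s \<in> \<Sigma> \<Longrightarrow> x \<in> G \<Longrightarrow> f s x * conjugate (f s x) = 1"
    and \<beta>_add: "\<And>s x y z. s \<in> \<Sigma> \<Longrightarrow> x \<in> G \<Longrightarrow> y \<in> G \<Longrightarrow> z \<in> G \<Longrightarrow> \<beta> s x (y + z) = \<beta> s x y * \<beta> s x z"
    and \<beta>_nondeg: "\<And>s t x. s \<in> \<Sigma> \<Longrightarrow> t \<in> \<Sigma> \<Longrightarrow> s \<noteq> t \<Longrightarrow> x \<in> G \<Longrightarrow> x \<noteq> 0 \<Longrightarrow>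
      \<exists>y\<in>G. \<beta> s x y \<noteq> \<beta> t x y"
  shows "\<exists>B :: nat \<Rightarrow> nat \<Rightarrow> 'a^'m^'m. mutually_unbiased_bases (n + 1) B"
proof -
  obtain g :: "'m \<Rightarrow> 'g" where g: "bij_betw g UNIV G"
    using card_G finite_G finite_same_card_bij[of "UNIV :: 'm set" G] by auto
  obtain d :: "nat \<Rightarrow> 'g" where d: "bij_betw d {1..CARD('m)} G"
    using card_G finite_G finite_same_card_bij[of "{1..CARD('m)}" G] by auto
  obtain \<sigma> :: "nat \<Rightarrow> 's" where \<sigma>: "bij_betw \<sigma> {1..n} \<Sigma>"
    using \<Sigma> finite_same_card_bij[of "{1..n}" \<Sigma>] by auto
  have dG: "d i \<in> G" if "i \<in> {1..CARD('m)}" for i using bij_betwE[OF d] that by auto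
  have d_eq: "d i = d j \<longleftrightarrow> i = j" if "i \<in> {1..CARD('m)}" "j \<in> {1..CARD('m)}" for i j
    using inj_on_eq_iff[OF bij_betw_imp_inj_on[OF d] that] .
  have \<sigma>S: "\<sigma> i \<in> \<Sigma>" if "i \<in> {1..n}" for i using bij_betwE[OF \<sigma>] that by auto
  have \<sigma>_neq: "\<sigma> i \<noteq> \<sigma> j" if "i \<in> {1..n}" "j \<in> {1..n}" "i \<noteq> j" for i j
    using inj_on_eq_iff[OF bij_betw_imp_inj_on[OF \<sigma>] that(1,2)] that(3) by simp
  \<comment> \<open>The index \<open>n + 1\<close> is the standard basis, of squared length 1; all
    other vectors have unimodular entries and squared length \<open>CARD('m)\<close>. Against the
    standard basis an inner product is a single unimodular entry.\<close>
  define \<phi> where "\<phi> k j u = (if k \<le> n then f (\<sigma> k) u * e (d j) u else of_bool (u = d j))" for k j u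
  define w where "w k j x = \<phi> k j (g x)" for k j x
  define N where "N k = (if k \<le> n then CARD('m) else 1)" for k
  define ip where "ip s i k j = (\<Sum>u\<in>G. \<phi> s i u * conjugate (\<phi> k j u))" for s i k j
  have ip: "(\<Sum>x\<in>UNIV. w s i x * conjugate (w k j x)) = ip s i k j" for s i k j
    unfolding w_def ip_def
    using sum.reindex_bij_betw[OF g, of "\<lambda>u. \<phi> s i u * conjugate (\<phi> k j u)"] by simp
  have zero_left: "e 0 u = 1" if u: "u \<in> G" for u
    using e_add_left[OF zero_mem zero_mem u] e_unit[OF zero_mem u] by auto
  have e_diff: "e x u * conjugate (e y u) = e (x - y) u" if "x \<in> G" "y \<in> G" "u \<in> G" for x y u
    using e_add_left[OF diff_mem[OF that(1,2)] that(2,3)] e_unit[OF that(2,3)]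
    by (simp add: mult.assoc)
  have conj_unit: "\<phi> k j u * conjugate (\<phi> k j u) = 1"
    if "k \<in> {1..n}" "j \<in> {1..CARD('m)}" "u \<in> G" for k j u
    using f_unit[OF \<sigma>S[OF that(1)] that(3)] e_unit[OF dG[OF that(2)] that(3)] that(1)
    by (simp add: \<phi>_def conjugate_dist_mul mult.assoc mult.left_commute[of "e _ _"])
  have orth: "ip k i k j = (if i = j then of_nat (N k) else 0)"
    if k: "k \<in> {1..n + 1}" and i: "i \<in> {1..CARD('m)}" and j: "j \<in> {1..CARD('m)}" for k i j
  proof (cases "k \<le> n")
    case True
    have "ip k i k j = (\<Sum>u\<in>G. e (d i - d j) u)"
      unfolding ip_def
    proof (intro sum.cong refl)
      fix u assume u: "u \<in> G"
      have "\<phi> k i u * conjugate (\<phi> k j u)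
          = f (\<sigma> k) u * conjugate (f (\<sigma> k) u) * (e (d i) u * conjugate (e (d j) u))"
        using True by (simp add: \<phi>_def conjugate_dist_mul mult_ac)
      then show "\<phi> k i u * conjugate (\<phi> k j u) = e (d i - d j) u"
        using f_unit[OF \<sigma>S u, of k] k True e_diff[OF dG[OF i] dG[OF j] u] by simp
    qed
    also have "\<dots> = (if i = j then of_nat (N k) else 0)"
    proof (cases "i = j")
      case False
      have D: "d i - d j \<in> G" "d i - d j \<noteq> 0"
        using False d_eq[OF i j] diff_mem[OF dG[OF i] dG[OF j]] by auto
      from e_nondeg[OF D] obtain v where "v \<in> G" "e (d i - d j) v \<noteq> 1" by auto
      then show ?thesis using False e_add_right[OF D(1)] by (simp add: sum_character_eq_0)
    qed (simp add: zero_left card_G N_def True)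
    finally show ?thesis .
  next
    case False
    have "ip k i k j = (\<Sum>u\<in>G. if u = d i then of_bool (i = j) else 0)"
      unfolding ip_def using False d_eq[OF i j] by (intro sum.cong refl) (auto simp: \<phi>_def)
    then show ?thesis using False dG[OF i] finite_G by (simp add: N_def)
  qed
  have cross_std: "ip s i k j * conjugate (ip s i k j) = 1"
    if "s \<in> {1..n}" "\<not> k \<le> n" "i \<in> {1..CARD('m)}" "j \<in> {1..CARD('m)}" for s i k j
  proof -
    have "ip s i k j = (\<Sum>u\<in>G. if u = d j then \<phi> s i (d j) else 0)"
      unfolding ip_def using that(2) by (intro sum.cong refl) (simp add: \<phi>_def[of k])
    then have "ip s i k j = \<phi> s i (d j)" using dG[OF that(4)] finite_G by simp
    then show ?thesis using conj_unit[OF that(1,3) dG[OF that(4)]] by simp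
  qed
  have ip_swap: "ip s i k j * conjugate (ip s i k j) = ip k j s i * conjugate (ip k j s i)" for s i k j
    by (simp add: ip_def sum_conjugate finite_G conjugate_dist_mul mult.commute)
  have cross: "ip s i k j * conjugate (ip s i k j) * of_nat CARD('m) = of_nat (N s) * of_nat (N k)"
    if s: "s \<in> {1..n + 1}" and k: "k \<in> {1..n + 1}" and sk: "s \<noteq> k"
      and i: "i \<in> {1..CARD('m)}" and j: "j \<in> {1..CARD('m)}" for s k i j
  proof -
    consider "s \<in> {1..n}" "\<not> k \<le> n" | "k \<in> {1..n}" "\<not> s \<le> n" | "s \<in> {1..n}" "k \<in> {1..n}"
      using s k sk by fastforce
    then show ?thesis
    proof cases
      case 1
      then show ?thesis using cross_std[OF 1 i j] by (simp add: N_def)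
    next
      case 2
      then show ?thesis using cross_std[OF 2 j i] ip_swap[of s i k j] by (simp add: N_def)
    next
      case 3
      \<comment> \<open>Polarisation makes \<open>\<beta>\<close> a quotient of unimodular values of
        \<open>f\<close>, so its conjugate is its inverse.\<close>
      have \<beta>_unit: "\<beta> k' x y * conjugate (\<beta> k' x y) = 1" if "k' \<in> \<Sigma>" "x \<in> G" "y \<in> G" for k' x y
      proof -
        have "f k' (x + y) * conjugate (f k' (x + y)) = (f k' x * conjugate (f k' x)) *
            (f k' y * conjugate (f k' y)) * (\<beta> k' x y * conjugate (\<beta> k' x y))"
          by (simp add: f_quad[OF that] conjugate_dist_mul mult_ac)
        then show ?thesis using f_unit that add_mem by simp
      qed
      have "ip s i k j * conjugate (ip s i k j) = of_nat (card G)"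
        unfolding ip_def
      proof (rule gauss_sum_mult_conjugate[where
            \<gamma> = "\<lambda>x y. \<beta> (\<sigma> s) x y * conjugate (\<beta> (\<sigma> k) x y)"])
        fix x y assume x: "x \<in> G" and y: "y \<in> G"
        show "\<phi> s i (x + y) * conjugate (\<phi> k j (x + y)) = \<phi> s i x * conjugate (\<phi> k j x) *
            (\<phi> s i y * conjugate (\<phi> k j y)) * (\<beta> (\<sigma> s) x y * conjugate (\<beta> (\<sigma> k) x y))"
          using 3 f_quad[OF \<sigma>S[OF 3(1)] x y] f_quad[OF \<sigma>S[OF 3(2)] x y]
            e_add_right[OF dG[OF i] x y] e_add_right[OF dG[OF j] x y]
          by (simp add: \<phi>_def conjugate_dist_mul mult_ac)
      next
        fix x assume x: "x \<in> G"
        have "\<phi> s i x * conjugate (\<phi> k j x) * conjugate (\<phi> s i x * conjugate (\<phi> k j x))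
          = (\<phi> s i x * conjugate (\<phi> s i x)) * (\<phi> k j x * conjugate (\<phi> k j x))"
          by (simp add: conjugate_dist_mul mult_ac)
        then show "\<phi> s i x * conjugate (\<phi> k j x) * conjugate (\<phi> s i x * conjugate (\<phi> k j x)) = 1"
          unfolding conj_unit[OF 3(1) i x] conj_unit[OF 3(2) j x] by simp
      next
        fix x y z assume xyz: "x \<in> G" "y \<in> G" "z \<in> G"
        show "\<beta> (\<sigma> s) x (y + z) * conjugate (\<beta> (\<sigma> k) x (y + z)) =
            \<beta> (\<sigma> s) x y * conjugate (\<beta> (\<sigma> k) x y) * (\<beta> (\<sigma> s) x z * conjugate (\<beta> (\<sigma> k) x z))"
          by (simp add: \<beta>_add[OF \<sigma>S[OF 3(1)] xyz] \<beta>_add[OF \<sigma>S[OF 3(2)] xyz] conjugate_dist_mul mult_ac)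
      next
        fix x assume x: "x \<in> G" "x \<noteq> 0"
        obtain y where y: "y \<in> G" "\<beta> (\<sigma> s) x y \<noteq> \<beta> (\<sigma> k) x y"
          using \<beta>_nondeg[OF \<sigma>S[OF 3(1)] \<sigma>S[OF 3(2)] \<sigma>_neq[OF 3 sk] x] by auto
        have "\<beta> (\<sigma> s) x y * conjugate (\<beta> (\<sigma> k) x y) \<noteq> 1"
        proof
          assume "\<beta> (\<sigma> s) x y * conjugate (\<beta> (\<sigma> k) x y) = 1"
          then have "\<beta> (\<sigma> s) x y * (\<beta> (\<sigma> k) x y * conjugate (\<beta> (\<sigma> k) x y)) = \<beta> (\<sigma> k) x y"
            by (simp add: mult_ac)
          then show False using \<beta>_unit[OF \<sigma>S[OF 3(2)] x(1) y(1)] y(2) by simp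
        qed
        then show "\<exists>y\<in>G. \<beta> (\<sigma> s) x y * conjugate (\<beta> (\<sigma> k) x y) \<noteq> 1" using y(1) by blast
      qed
      then show ?thesis using 3 by (simp add: N_def card_G)
    qed
  qed
  show ?thesis
    by (rule mutually_unbiased_bases_of_vectors[where w = w and N = N], unfold ip)
      (simp add: N_def, erule (2) orth, erule (4) cross)
qed

end

section \<open>Finite fields and traces\<close>

text \<open>Split off one linear factor at a time; a simple root is not a root of the cofactor, so
  every step removes exactly one root.\<close>

lemma card_roots_separable:
  fixes P :: "'l::alg_closed_field poly"
  assumes "P \<noteq> 0" "\<And>x. poly P x = 0 \<Longrightarrow> poly (pderiv P) x \<noteq> 0"
  shows "card {x. poly P x = 0} = Polynomial.degree P"
  using assms
proof (induction "Polynomial.degree P" arbitrary: P rule: less_induct)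
  case less
  show ?case
  proof (cases "Polynomial.degree P = 0")
    case True
    then have "poly P x \<noteq> 0" for x using less.prems(1) by (auto elim!: degree_eq_zeroE)
    then show ?thesis using True by simp
  next
    case False
    then obtain x where x: "poly P x = 0" using alg_closed_imp_poly_has_root[of P] by auto
    then obtain Q where P: "P = [:- x, 1:] * Q" by (auto simp: poly_eq_0_iff_dvd)
    have Q0: "Q \<noteq> 0" using less.prems(1) P by auto
    have deg: "Polynomial.degree P = Suc (Polynomial.degree Q)" unfolding P by (subst degree_mult_eq) (use Q0 in auto)
    have deriv: "poly (pderiv P) y = poly Q y + (y - x) * poly (pderiv Q) y" for y
      unfolding P pderiv_mult by (simp add: pderiv_pCons algebra_simps)
    have Qx: "poly Q x \<noteq> 0" using less.prems(2)[OF x] deriv[of x] by simp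
    have "poly (pderiv Q) y \<noteq> 0" if "poly Q y = 0" for y
      using less.prems(2)[of y] deriv[of y] that by (auto simp: P)
    then have "card {y. poly Q y = 0} = Polynomial.degree Q" using deg Q0 by (intro less.hyps) auto
    moreover have "{y. poly P y = 0} = insert x {y. poly Q y = 0}" by (auto simp: P)
    ultimately show ?thesis using Qx deg poly_roots_finite[OF Q0] by simp
  qed
qed

text \<open>The subfield with \<open>CHAR('l) ^ n\<close> elements, as the fixed points of a
  Frobenius power. \<open>gf (Suc 0)\<close> is the prime field, whereas \<open>gf 0\<close> is the
  whole field, whence the assumption \<open>n > 0\<close> in counting arguments.\<close>

definition gf :: "nat \<Rightarrow> 'l::{field_prime_char, alg_closed_field} set" where
  "gf n = {x. x ^ (CHAR('l) ^ n) = x}"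

definition ftrace :: "nat \<Rightarrow> 'l::{field_prime_char, alg_closed_field} \<Rightarrow> 'l" where
  "ftrace n x = (\<Sum>i<n. x ^ (CHAR('l) ^ i))"

lemma CHAR_gt_1: "CHAR('l::field_prime_char) > 1"
  by (rule prime_gt_1_nat[OF CHAR_prime])

lemma frobenius_add: "(x + y :: 'l::field_prime_char) ^ (CHAR('l) ^ i) = x ^ (CHAR('l) ^ i) + y ^ (CHAR('l) ^ i)"
  by (rule freshmans_dream') simp_all

context
  fixes n :: nat
begin

lemma gf_zero [simp]: "0 \<in> gf n"
  and gf_one [simp]: "1 \<in> gf n"
  and gf_add: "x \<in> gf n \<Longrightarrow> y \<in> gf n \<Longrightarrow> x + y \<in> gf n"
  and gf_mult: "x \<in> gf n \<Longrightarrow> y \<in> gf n \<Longrightarrow> x * y \<in> gf n"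
  and gf_power: "x \<in> gf n \<Longrightarrow> x ^ i \<in> gf n"
  and gf_inverse: "x \<in> gf n \<Longrightarrow> inverse x \<in> gf n"
proof -
  show "x \<in> gf n \<Longrightarrow> x ^ i \<in> gf n"
    by (simp add: gf_def) (metis power_mult mult.commute)
qed (simp_all add: gf_def frobenius_add power_mult_distrib power_inverse)

lemma gf_diff:
  assumes "x \<in> gf n" "y \<in> gf n"
  shows "x - y \<in> gf n"
proof -
  have "(x - y + y) ^ (CHAR('a) ^ n) = (x - y) ^ (CHAR('a) ^ n) + y" (is "?l = _")
    unfolding frobenius_add using assms by (simp add: gf_def)
  moreover have "?l = x" using assms by (simp add: gf_def)
  ultimately show ?thesis by (simp add: gf_def eq_diff_eq)
qed

lemma gf_of_nat [simp]: "of_nat k \<in> gf n"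
  by (induction k) (simp_all add: gf_add)

lemma gf_1_power:
  assumes "c \<in> gf (Suc 0)"
  shows "c ^ (CHAR('l) ^ i) = (c :: 'l::{field_prime_char, alg_closed_field})"
proof (induction i)
  case (Suc i)
  have "c ^ (CHAR('l) ^ Suc i) = (c ^ CHAR('l)) ^ (CHAR('l) ^ i)" by (simp add: power_mult)
  then show ?case using assms Suc by (simp add: gf_def)
qed simp

lemma gf_1_subset: "gf (Suc 0) \<subseteq> gf n"
  using gf_1_power by (auto simp: gf_def)

text \<open>With \<open>q = CHAR('l) ^ n\<close>, the polynomial \<open>X^q - X\<close> has
  derivative -1, so all its roots are simple.\<close>

lemma card_gf:
  assumes "n > 0"
  shows "card (gf n :: 'l::{field_prime_char, alg_closed_field} set) = CHAR('l) ^ n"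
    and "finite (gf n :: 'l set)"
proof -
  let ?q = "CHAR('l) ^ n"
  let ?P = "Polynomial.monom 1 ?q - Polynomial.monom 1 1 :: 'l poly"
  have q: "?q > 1" using one_less_power[OF CHAR_gt_1 assms] .
  have deg: "Polynomial.degree ?P = ?q"
    using q degree_add_eq_left[of "- Polynomial.monom 1 1" "Polynomial.monom 1 ?q :: 'l poly"]
    by (simp add: degree_monom_eq)
  then have P0: "?P \<noteq> 0" using q by auto
  have roots: "{x. poly ?P x = 0} = gf n" by (auto simp: gf_def poly_monom)
  have "(of_nat ?q :: 'l) = 0" using assms by simp
  then have "poly (pderiv ?P) x = -1" for x :: 'l
    by (simp add: pderiv_diff pderiv_monom poly_monom del: of_nat_power)
  then have "card {x. poly ?P x = 0} = Polynomial.degree ?P"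
    using P0 by (intro card_roots_separable) auto
  then show "card (gf n :: 'l set) = ?q" unfolding roots deg .
  show "finite (gf n :: 'l set)" unfolding roots[symmetric] using P0 by (rule poly_roots_finite)
qed

lemma ftrace_add: "ftrace n (x + y) = ftrace n x + ftrace n y"
  by (simp add: ftrace_def frobenius_add sum.distrib)

lemma ftrace_zero [simp]: "ftrace n 0 = 0"
  by (simp add: ftrace_def power_0_left)

lemma ftrace_one: "ftrace n 1 = of_nat n"
  by (simp add: ftrace_def)

lemma ftrace_scale:
  assumes "c \<in> gf (Suc 0)"
  shows "ftrace n (c * x) = c * ftrace n x"
  by (simp add: ftrace_def power_mult_distrib gf_1_power[OF assms] sum_distrib_left)

lemma sum_shift_cyclic:
  fixes a :: "nat \<Rightarrow> 'a::ab_group_add"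
  assumes "a n = a 0"
  shows "(\<Sum>i<n. a (Suc i)) = (\<Sum>i<n. a i)"
  using sum.lessThan_Suc_shift[of a n] sum.lessThan_Suc[of a n] assms by (simp add: add.commute)

text \<open>Frobenius permutes the summands of the trace cyclically.\<close>

lemma ftrace_mem:
  assumes "x \<in> gf n"
  shows "ftrace n x \<in> gf (Suc 0)"
proof -
  have "ftrace n x ^ CHAR('a) = (\<Sum>i<n. x ^ (CHAR('a) ^ Suc i))"
    unfolding ftrace_def by (subst freshmans_dream_sum) (simp_all add: mult.commute flip: power_mult)
  also have "\<dots> = ftrace n x"
    unfolding ftrace_def using assms sum_shift_cyclic[of "\<lambda>i. x ^ (CHAR('a) ^ i)"] by (simp add: gf_def)
  finally show ?thesis by (simp add: gf_def)
qed

text \<open>The trace is a nonzero polynomial of degree at most \<open>CHAR('l) ^ (n - 1)\<close>,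
  too small to vanish on all of \<open>gf n\<close>.\<close>

lemma ftrace_nondegenerate:
  fixes x :: "'l::{field_prime_char, alg_closed_field}"
  assumes "n > 0" "x \<in> gf n" "x \<noteq> 0"
  obtains y where "y \<in> gf n" "ftrace n (x * y) = 1"
proof -
  let ?p = "CHAR('l)"
  let ?T = "\<Sum>i<n. Polynomial.monom 1 (?p ^ i) :: 'l poly"
  have "Polynomial.coeff ?T (?p ^ (n - 1)) = (\<Sum>i<n. of_bool (i = n - 1))"
    unfolding coeff_sum using CHAR_gt_1[where 'l = 'l]
    by (intro sum.cong refl) (auto simp: power_inject_exp)
  also have "\<dots> = 1" using assms(1) by (simp add: of_bool_def)
  finally have T0: "?T \<noteq> 0" by auto
  have "Polynomial.degree ?T \<le> ?p ^ (n - 1)"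
  proof (rule degree_sum_le)
    fix i assume "i \<in> {..<n}"
    then have "?p ^ i \<le> ?p ^ (n - 1)" by (intro power_increasing) (auto simp: Suc_le_eq)
    then show "Polynomial.degree (Polynomial.monom 1 (?p ^ i) :: 'l poly) \<le> ?p ^ (n - 1)"
      using degree_monom_le order_trans by blast
  qed simp
  then have "card {z. poly ?T z = 0} \<le> ?p ^ (n - 1)"
    using card_poly_roots_bound[OF T0] by simp
  also have "\<dots> < ?p ^ n" using CHAR_gt_1 assms(1) by (intro power_strict_increasing) auto
  also have "\<dots> = card (gf n :: 'l set)" using card_gf(1)[OF assms(1)] ..
  finally have "\<not> gf n \<subseteq> {z. poly ?T z = 0}"
    using card_mono[OF poly_roots_finite[OF T0]] by (meson linorder_not_less)
  then obtain z where z: "z \<in> gf n" "poly ?T z \<noteq> 0" by auto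
  then have tz: "ftrace n z \<noteq> 0" by (simp add: ftrace_def poly_sum poly_monom)
  have c: "inverse (ftrace n z) \<in> gf (Suc 0)"
    using ftrace_mem[OF z(1)] by (simp add: gf_def power_inverse)
  \<comment> \<open>The factor \<open>inverse x\<close> cancels \<open>x\<close>; the inverse of the
    trace of \<open>z\<close> is a prime field scalar, so it passes through the trace and normalises
    it to 1.\<close>
  define y where "y = inverse (ftrace n z) * (z * inverse x)"
  have "y \<in> gf n" unfolding y_def using c gf_1_subset z(1) assms(2) by (blast intro: gf_mult gf_inverse)
  moreover have "ftrace n (x * y) = ftrace n (inverse (ftrace n z) * z)"
    using assms(3) by (simp add: y_def mult.left_commute[of x])
  then have "ftrace n (x * y) = 1" using ftrace_scale[OF c, of z] tz by simp
  ultimately show ?thesis by (rule that)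
qed

end

lemma gf_1_eq: "gf (Suc 0) = (of_nat ` {..<CHAR('l)} :: 'l::{field_prime_char, alg_closed_field} set)"
proof (rule card_subset_eq[symmetric])
  show "finite (gf (Suc 0) :: 'l set)" by (rule card_gf) simp
  show "of_nat ` {..<CHAR('l)} \<subseteq> (gf (Suc 0) :: 'l set)" by auto
  have "inj_on (of_nat :: nat \<Rightarrow> 'l) {..<CHAR('l)}"
    by (auto simp: inj_on_def of_nat_eq_iff_cong_CHAR cong_def)
  then show "card (of_nat ` {..<CHAR('l)} :: 'l set) = card (gf (Suc 0) :: 'l set)"
    by (simp add: card_image card_gf)
qed

text \<open>The additive character of the prime field sending 1 to \<open>\<zeta>\<close>. Any lift
  of \<open>y\<close> to a natural number serves once \<open>\<zeta> ^ CHAR('l) = 1\<close>;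
  elsewhere the exponent is unspecified, but the value is still a power of
  \<open>\<zeta>\<close>.\<close>

definition prime_field_character :: "'a::monoid_mult \<Rightarrow> 'l::semiring_1 \<Rightarrow> 'a" where
  "prime_field_character \<zeta> y = \<zeta> ^ (SOME k. of_nat k = y)"

lemma prime_field_character_of_nat:
  assumes "\<zeta> ^ CHAR('l) = 1"
  shows "prime_field_character \<zeta> (of_nat k :: 'l::{field_prime_char, alg_closed_field}) = \<zeta> ^ k"
proof -
  have red: "\<zeta> ^ j = \<zeta> ^ (j mod CHAR('l))" for j
  proof -
    have "\<zeta> ^ j = \<zeta> ^ (CHAR('l) * (j div CHAR('l)) + j mod CHAR('l))" by simp
    also have "\<dots> = \<zeta> ^ (j mod CHAR('l))" unfolding power_add power_mult assms by simp
    finally show ?thesis .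
  qed
  define j where "j = (SOME j. of_nat j = (of_nat k :: 'l))"
  have "of_nat j = (of_nat k :: 'l)" unfolding j_def by (rule someI) simp
  then have "j mod CHAR('l) = k mod CHAR('l)" by (simp add: of_nat_eq_iff_cong_CHAR cong_def)
  then show ?thesis unfolding prime_field_character_def j_def[symmetric] by (metis red)
qed

context
  fixes \<zeta> :: "'a::monoid_mult" and L :: "'l::{field_prime_char, alg_closed_field} itself"
  assumes \<zeta>: "\<zeta> ^ CHAR('l) = 1"
begin

lemma prime_field_character_add:
  assumes "x \<in> gf (Suc 0)" "y \<in> (gf (Suc 0) :: 'l set)"
  shows "prime_field_character \<zeta> (x + y) = prime_field_character \<zeta> x * prime_field_character \<zeta> y"
proof -
  obtain i j where ij: "x = of_nat i" "y = of_nat j" using assms unfolding gf_1_eq by blast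
  show ?thesis unfolding ij of_nat_add[symmetric] prime_field_character_of_nat[OF \<zeta>] power_add ..
qed

lemma prime_field_character_0: "prime_field_character \<zeta> (0 :: 'l) = 1"
  using prime_field_character_of_nat[OF \<zeta>, of 0] by simp

lemma prime_field_character_1: "prime_field_character \<zeta> (1 :: 'l) = \<zeta>"
  using prime_field_character_of_nat[OF \<zeta>, of 1] by simp

end

lemma prime_field_character_unit:
  assumes "\<zeta> * conjugate \<zeta> = (1 :: 'a::frame_scalar)"
  shows "prime_field_character \<zeta> y * conjugate (prime_field_character \<zeta> y) = 1"
proof -
  have "\<zeta> ^ k * conjugate (\<zeta> ^ k) = 1" for k
  proof (induction k)
    case (Suc k)
    have "\<zeta> ^ Suc k * conjugate (\<zeta> ^ Suc k) = (\<zeta> * conjugate \<zeta>) * (\<zeta> ^ k * conjugate (\<zeta> ^ k))"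
      by (simp add: conjugate_dist_mul mult_ac)
    then show ?case using Suc assms by simp
  qed simp
  then show ?thesis by (simp add: prime_field_character_def)
qed

section \<open>The second elementary symmetric function of the conjugates\<close>

definition esym2 :: "(nat \<Rightarrow> 'a::comm_ring_1) \<Rightarrow> nat \<Rightarrow> 'a" where
  "esym2 a n = (\<Sum>j<n. a j * (\<Sum>i<j. a i))"

lemma esym2_Suc: "esym2 a (Suc n) = esym2 a n + a n * (\<Sum>i<n. a i)"
  by (simp add: esym2_def)

lemma esym2_Suc_shift: "esym2 a (Suc n) = esym2 (\<lambda>i. a (Suc i)) n + a 0 * (\<Sum>i<n. a (Suc i))"
proof (induction n)
  case (Suc n)
  have "esym2 a (Suc (Suc n)) = esym2 (\<lambda>i. a (Suc i)) n + a 0 * (\<Sum>i<n. a (Suc i)) + a (Suc n) * (\<Sum>i<Suc n. a i)"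
    unfolding esym2_Suc[of a "Suc n"] Suc ..
  then show ?case
    unfolding sum.lessThan_Suc_shift[of a n] esym2_Suc[of "\<lambda>i. a (Suc i)" n]
    by (simp add: algebra_simps)
qed (simp add: esym2_def)

text \<open>Expand the function of \<open>n + 1\<close> arguments at its last and at its first index
  and compare. Frobenius rotates the conjugates, so this places \<open>ftrace2\<close> in the prime
  field.\<close>

lemma esym2_shift_cyclic:
  assumes "a n = a 0"
  shows "esym2 (\<lambda>i. a (Suc i)) n = esym2 a n"
  using esym2_Suc[of a n] esym2_Suc_shift[of a n] sum_shift_cyclic[of a n] assms by simp

text \<open>The mixed terms are the products \<open>a i * b j\<close> with distinct indices: all
  products minus the diagonal.\<close>

lemma esym2_add:
  "esym2 (\<lambda>i. a i + b i) n = esym2 a n + esym2 b n + (\<Sum>i<n. a i) * (\<Sum>i<n. b i) - (\<Sum>i<n. a i * b i)"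
  by (induction n) (simp_all add: esym2_Suc sum.distrib algebra_simps, simp add: esym2_def)

text \<open>In characteristic 2 this is a quadratic form over GF(2) with polarisation
  \<open>Tr x Tr y + Tr (x y)\<close>, which is alternating.\<close>

definition ftrace2 :: "nat \<Rightarrow> 'l::{field_prime_char, alg_closed_field} \<Rightarrow> 'l" where
  "ftrace2 n x = esym2 (\<lambda>i. x ^ (CHAR('l) ^ i)) n"

lemma ftrace2_add:
  "ftrace2 n (x + y) = ftrace2 n x + ftrace2 n y + ftrace n x * ftrace n y - ftrace n (x * y)"
  by (simp add: ftrace2_def ftrace_def frobenius_add esym2_add power_mult_distrib)

lemma ftrace2_mem:
  fixes x :: "'l::{field_prime_char, alg_closed_field}"
  assumes "x \<in> gf n"
  shows "ftrace2 n x \<in> gf (Suc 0)"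
proof -
  have "ftrace2 n x ^ CHAR('l) = esym2 (\<lambda>i. x ^ (CHAR('l) ^ Suc i)) n"
    unfolding ftrace2_def esym2_def
    by (simp add: freshmans_dream_sum power_mult_distrib mult.commute flip: power_mult)
  also have "\<dots> = ftrace2 n x"
    unfolding ftrace2_def using assms esym2_shift_cyclic[of "\<lambda>i. x ^ (CHAR('l) ^ i)" n] by (simp add: gf_def)
  finally show ?thesis by (simp add: gf_def)
qed

lemma gf_1_char_2:
  assumes "CHAR('l::{field_prime_char, alg_closed_field}) = 2" "x \<in> (gf (Suc 0) :: 'l set)"
  shows "x = 0 \<or> x = 1"
  using assms(2) unfolding gf_1_eq assms(1) by (auto simp: lessThan_nat_numeral)

section \<open>Unbiased bases over finite fields\<close>

lemma finite_additive_subgroup_gf: "n > 0 \<Longrightarrow> finite_additive_subgroup (gf n)"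
  by unfold_locales (simp_all add: card_gf gf_diff)

definition trace_character ::
    "'a::monoid_mult \<Rightarrow> nat \<Rightarrow> 'l::{field_prime_char, alg_closed_field} \<Rightarrow> 'a" where
  "trace_character \<zeta> n x = prime_field_character \<zeta> (ftrace n x)"

lemma trace_character_unit:
  "\<zeta> * conjugate \<zeta> = (1 :: 'a::frame_scalar) \<Longrightarrow>
    trace_character \<zeta> n x * conjugate (trace_character \<zeta> n x) = 1"
  unfolding trace_character_def by (rule prime_field_character_unit)

lemma trace_character_add:
  assumes "\<zeta> ^ CHAR('l) = 1" "x \<in> gf n" "y \<in> gf n"
  shows "trace_character \<zeta> n (x + y :: 'l::{field_prime_char, alg_closed_field})
    = trace_character \<zeta> n x * trace_character \<zeta> n y"
  unfolding trace_character_def ftrace_add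
  by (rule prime_field_character_add[OF assms(1) ftrace_mem[OF assms(2)] ftrace_mem[OF assms(3)]])

lemma trace_character_nondegenerate:
  assumes "\<zeta> ^ CHAR('l) = 1" "\<zeta> \<noteq> 1" "n > 0"
    and "x \<in> gf n" "x \<noteq> (0 :: 'l::{field_prime_char, alg_closed_field})"
  shows "\<exists>y\<in>gf n. trace_character \<zeta> n (x * y) \<noteq> 1"
proof -
  obtain y where "y \<in> gf n" "ftrace n (x * y) = 1"
    using ftrace_nondegenerate[OF assms(3,4,5)] .
  then show ?thesis using assms(2) prime_field_character_1[OF assms(1)]
    by (intro bexI[of _ y]) (simp_all add: trace_character_def)
qed

text \<open>The polarisations for \<open>s\<close> and \<open>t\<close> differ by the character of
  \<open>(s - t) * x * y\<close>, nondegenerate because a field has no zero divisors and the trace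
  form is nondegenerate. Each characteristic only has to supply \<open>f\<close>.\<close>

lemma mutually_unbiased_bases_of_field:
  fixes \<zeta> :: "'a::frame_scalar" and f :: "'l::{field_prime_char, alg_closed_field} \<Rightarrow> 'l \<Rightarrow> 'a"
  assumes \<zeta>: "\<zeta> ^ CHAR('l) = 1" "\<zeta> \<noteq> 1" "\<zeta> * conjugate \<zeta> = 1"
    and n: "n > 0" and card: "CARD('m::finite) = CHAR('l) ^ n"
    and f_quad: "\<And>s x y. s \<in> gf n \<Longrightarrow> x \<in> gf n \<Longrightarrow> y \<in> gf n \<Longrightarrow>
      f s (x + y) = f s x * f s y * trace_character \<zeta> n (s * x * y)"
    and f_unit: "\<And>s x. s \<in> gf n \<Longrightarrow> x \<in> gf n \<Longrightarrow> f s x * conjugate (f s x) = 1"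
  shows "\<exists>B :: nat \<Rightarrow> nat \<Rightarrow> 'a^'m^'m. mutually_unbiased_bases (CARD('m) + 1) B"
proof -
  interpret finite_additive_subgroup "gf n :: 'l set" by (rule finite_additive_subgroup_gf[OF n])
  note add = trace_character_add[OF \<zeta>(1)]
  show ?thesis
  proof (rule mutually_unbiased_bases_of_quadratic_functions[where \<Sigma> = "gf n" and f = f
        and e = "\<lambda>x y. trace_character \<zeta> n (x * y)"
        and \<beta> = "\<lambda>s x y. trace_character \<zeta> n (s * x * y)"])
    show "card (gf n :: 'l set) = CARD('m)" "card (gf n :: 'l set) = CARD('m)"
      using card_gf(1)[OF n] card by simp_all
    show "finite (gf n :: 'l set)" by (rule finite_G)
    show "\<exists>y\<in>gf n. trace_character \<zeta> n (x * y) \<noteq> 1" if "x \<in> gf n" "x \<noteq> 0" for x :: 'l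
      by (rule trace_character_nondegenerate[OF \<zeta>(1,2) n that])
    show "\<exists>y\<in>gf n. trace_character \<zeta> n (s * x * y) \<noteq> trace_character \<zeta> n (t * x * y)"
      if s: "s \<in> gf n" and t: "t \<in> gf n" and "s \<noteq> t" and x: "x \<in> gf n" "x \<noteq> 0" for s t x :: 'l
    proof -
      have "(s - t) * x \<in> gf n" "(s - t) * x \<noteq> 0" using that by (auto intro: gf_mult gf_diff)
      then obtain y where y: "y \<in> gf n" "trace_character \<zeta> n ((s - t) * x * y) \<noteq> 1"
        using trace_character_nondegenerate[OF \<zeta>(1,2) n] by blast
      have "trace_character \<zeta> n (s * x * y) = trace_character \<zeta> n ((s - t) * x * y + t * x * y)"
        by (simp add: algebra_simps)
      also have "\<dots> = trace_character \<zeta> n ((s - t) * x * y) * trace_character \<zeta> n (t * x * y)"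
        using that y(1) by (intro add gf_mult gf_diff)
      moreover have "trace_character \<zeta> n (t * x * y) \<noteq> 0"
        using trace_character_unit[OF \<zeta>(3), of n "t * x * y"] by auto
      ultimately show ?thesis using y by (intro bexI[of _ y]) simp_all
    qed
  qed (simp_all add: distrib_left distrib_right add gf_mult trace_character_unit[OF \<zeta>(3)] f_quad f_unit)
qed

text \<open>Since 2 is invertible, \<open>s * x * y\<close> is the polarisation of half of
  \<open>s * (x * x)\<close>.\<close>

lemma complex_mub_odd_characteristic:
  assumes odd: "CHAR('l::{field_prime_char, alg_closed_field}) \<noteq> 2"
    and n: "n > 0" and card: "CARD('m::finite) = CHAR('l) ^ n"
  shows "\<exists>B :: nat \<Rightarrow> nat \<Rightarrow> complex^'m^'m. mutually_unbiased_bases (CARD('m) + 1) B"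
proof -
  define \<zeta> where "\<zeta> = cis (2 * pi / real CHAR('l))"
  have p: "CHAR('l) > 2" using odd CHAR_gt_1[where 'l = 'l] by simp
  have \<zeta>1: "\<zeta> ^ CHAR('l) = 1" unfolding \<zeta>_def Complex.DeMoivre using p by simp
  \<comment> \<open>The characteristic exceeds 2, so the angle lies strictly between 0 and
    \<open>pi\<close>, where the cosine is below 1.\<close>
  have "cos (2 * pi / real CHAR('l)) < cos 0"
    using p by (intro cos_monotone_0_pi) (simp_all add: field_simps)
  then have \<zeta>2: "\<zeta> \<noteq> 1" by (auto simp: \<zeta>_def complex_eq_iff)
  have \<zeta>3: "\<zeta> * conjugate \<zeta> = 1" by (simp add: \<zeta>_def cis_cnj cis_mult)
  have two: "(2 :: 'l) \<noteq> 0"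
  proof
    assume "(2 :: 'l) = 0"
    then have "of_nat 2 = (0 :: 'l)" by simp
    then have "CHAR('l) dvd 2" by (simp only: of_nat_eq_0_iff_char_dvd)
    then show False using p by (auto dest: dvd_imp_le)
  qed
  have half: "inverse 2 \<in> (gf n :: 'l set)" using gf_inverse[OF gf_of_nat[of 2 n]] by simp
  let ?f = "\<lambda>s x :: 'l. trace_character \<zeta> n (inverse 2 * s * (x * x))"
  show ?thesis
  proof (rule mutually_unbiased_bases_of_field[OF \<zeta>1 \<zeta>2 \<zeta>3 n card, where f = ?f])
    fix s x y :: 'l assume s: "s \<in> gf n" and x: "x \<in> gf n" and y: "y \<in> gf n"
    have "inverse 2 * s * ((x + y) * (x + y)) =
        inverse 2 * s * (x * x) + inverse 2 * s * (y * y) + (2 * inverse 2) * (s * x * y)"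
      by (simp only: algebra_simps mult_2)
    also have "\<dots> = inverse 2 * s * (x * x) + inverse 2 * s * (y * y) + s * x * y"
      using two by simp
    finally have eq: "inverse 2 * s * ((x + y) * (x + y))
        = inverse 2 * s * (x * x) + inverse 2 * s * (y * y) + s * x * y" .
    show "?f s (x + y) = ?f s x * ?f s y * trace_character \<zeta> n (s * x * y)"
      unfolding eq by (simp only: trace_character_add[OF \<zeta>1] gf_add gf_mult half s x y)
  qed (rule trace_character_unit[OF \<zeta>3])
qed

abbreviation gf2_sign :: "'l::{field_prime_char, alg_closed_field} \<Rightarrow> 'a::frame_scalar" where
  "gf2_sign \<equiv> prime_field_character (- 1)"

text \<open>In characteristic 2 the form \<open>Tr (r\<^sup>2 x y)\<close> is not alternating.
  It is the polarisation of the \<open>\<int>/4\<close>-valued quadratic form \<open>x \<mapsto> [Tr (r x)] + 2 Q (r x)\<close>, where \<open>Q\<close> is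
  \<open>ftrace2\<close> and brackets denote the lift of 0 and 1 to integers.\<close>

lemma complex_mub_even_characteristic:
  assumes two: "CHAR('l::{field_prime_char, alg_closed_field}) = 2"
    and n: "n > 0" and card: "CARD('m::finite) = CHAR('l) ^ n"
  shows "\<exists>B :: nat \<Rightarrow> nat \<Rightarrow> complex^'m^'m. mutually_unbiased_bases (CARD('m) + 1) B"
proof -
  have \<zeta>: "(- 1 :: complex) ^ CHAR('l) = 1" "(- 1 :: complex) \<noteq> 1" "(- 1 :: complex) * conjugate (- 1) = 1"
    by (simp_all add: two)
  note sign_add = prime_field_character_add[OF \<zeta>(1)]
  have char2: "- x = x" for x :: 'l by (rule uminus_CHAR_2[OF two])
  have self_add: "x + x = 0" for x :: 'l using char2[of x] by (metis add.right_inverse)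
  define \<kappa> :: "'l \<Rightarrow> complex" where "\<kappa> y = (if y = 0 then 1 else \<i>)" for y
  \<comment> \<open>The inverse of Frobenius on \<open>gf n\<close>: squaring raises the exponent to
    \<open>2 ^ n\<close>, which fixes \<open>s\<close>.\<close>
  define root where "root s = (s :: 'l) ^ (2 ^ (n - 1))" for s
  have root: "root s \<in> gf n" "root s * root s = s" if "s \<in> gf n" for s
  proof -
    show "root s \<in> gf n" using that unfolding root_def by (rule gf_power)
    have "root s * root s = s ^ (2 ^ Suc (n - 1))"
      by (simp add: root_def mult_2 flip: power_add)
    then show "root s * root s = s" using that n by (simp add: gf_def two)
  qed
  \<comment> \<open>\<open>\<kappa>\<close> fails to be a character only at
    \<open>a = b = 1\<close>, where the sum is 0 but \<open>\<i>\<close> squared is -1.\<close>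
  have \<kappa>_add: "\<kappa> (a + b) = \<kappa> a * \<kappa> b * gf2_sign (a * b)" if "a \<in> gf (Suc 0)" "b \<in> gf (Suc 0)" for a b
    using gf_1_char_2[OF two that(1)] gf_1_char_2[OF two that(2)] self_add[of 1]
    by (auto simp: \<kappa>_def prime_field_character_0[OF \<zeta>(1)] prime_field_character_1[OF \<zeta>(1)])
  let ?f = "\<lambda>s x. \<kappa> (ftrace n (root s * x)) * gf2_sign (ftrace2 n (root s * x))"
  show ?thesis
  proof (rule mutually_unbiased_bases_of_field[OF \<zeta> n card, where f = ?f])
    fix s x y :: 'l assume s: "s \<in> gf n" and x: "x \<in> gf n" and y: "y \<in> gf n"
    let ?x = "root s * x" and ?y = "root s * y"
    have mem: "?x \<in> gf n" "?y \<in> gf n" "?x * ?y \<in> gf n" using root s x y by (auto intro: gf_mult)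
    have sxy: "s * x * y = ?x * ?y" using root(2)[OF s] by (metis mult.assoc mult.left_commute)
    have "ftrace2 n (?x + ?y) = ftrace2 n ?x + ftrace2 n ?y + ftrace n ?x * ftrace n ?y + ftrace n (?x * ?y)"
      unfolding ftrace2_add by (simp add: char2 diff_conv_add_uminus del: add_uminus_conv_diff)
    then have "gf2_sign (ftrace2 n (?x + ?y)) = gf2_sign (ftrace2 n ?x) * gf2_sign (ftrace2 n ?y) *
        gf2_sign (ftrace n ?x * ftrace n ?y) * trace_character (- 1 :: complex) n (?x * ?y)"
      using mem by (simp add: trace_character_def sign_add ftrace_mem ftrace2_mem gf_add gf_mult)
    moreover have "\<kappa> (ftrace n (?x + ?y)) =
        \<kappa> (ftrace n ?x) * \<kappa> (ftrace n ?y) * gf2_sign (ftrace n ?x * ftrace n ?y)"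
      unfolding ftrace_add using mem by (intro \<kappa>_add ftrace_mem)
    \<comment> \<open>The defect of \<open>\<kappa>\<close> equals the sign contributed by the
      product of traces in the polarisation of \<open>ftrace2\<close>; the two cancel and only the
      trace of \<open>?x * ?y\<close> remains.\<close>
    moreover have "gf2_sign (ftrace n ?x * ftrace n ?y) * gf2_sign (ftrace n ?x * ftrace n ?y) = (1 :: complex)"
      using mem by (simp add: sign_add[symmetric] ftrace_mem gf_mult self_add prime_field_character_0[OF \<zeta>(1)])
    ultimately show "?f s (x + y) = ?f s x * ?f s y * trace_character (- 1) n (s * x * y)"
      unfolding sxy distrib_left by (simp add: mult_ac)
  next
    fix s x :: 'l
    show "?f s x * conjugate (?f s x) = 1"
      using prime_field_character_unit[OF \<zeta>(3), of "ftrace2 n (root s * x)"]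
      by (simp add: \<kappa>_def mult_ac)
  qed
qed

text \<open>The Kerdock construction: the alternating forms
  \<open>((x, a), (y, b)) \<mapsto> Tr (s x) Tr (s y) + Tr (s\<^sup>2 x y) + a Tr (s y) + b Tr (s x)\<close> on
  \<open>GF(2\<^sup>n) \<times> GF(2)\<close>, with \<open>n\<close> odd and \<open>s \<in> GF(2\<^sup>n)\<close>, have nonsingular pairwise differences.\<close>

lemma real_mub_kerdock:
  assumes two: "CHAR('l::{field_prime_char, alg_closed_field}) = 2"
    and n: "odd n" and card: "CARD('m::finite) = 2 ^ (n + 1)"
  shows "\<exists>B :: nat \<Rightarrow> nat \<Rightarrow> real^'m^'m. mutually_unbiased_bases (CARD('m) div 2 + 1) B"
proof -
  have n0: "n > 0" using n by (simp add: odd_pos)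
  have \<zeta>: "(- 1 :: real) ^ CHAR('l) = 1" "(- 1 :: real) \<noteq> 1" "(- 1 :: real) * conjugate (- 1) = 1"
    by (simp_all add: two)
  note sign_add = prime_field_character_add[OF \<zeta>(1)]
  note sign_0 = prime_field_character_0[OF \<zeta>(1)] and sign_1 = prime_field_character_1[OF \<zeta>(1)]
  have char2: "- x = x" for x :: 'l by (rule uminus_CHAR_2[OF two])
  have self_add: "x + x = 0" for x :: 'l using char2[of x] by (metis add.right_inverse)
  have sub: "x - y = x + y" for x y :: 'l using char2[of y] by (metis diff_conv_add_uminus)
  have sign_inj: "x = y" if "x \<in> gf (Suc 0)" "y \<in> gf (Suc 0)" "gf2_sign x = (gf2_sign y :: real)" for x y :: 'l
    using gf_1_char_2[OF two that(1)] gf_1_char_2[OF two that(2)] that(3) by (auto simp: sign_0 sign_1)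
  \<comment> \<open>Oddness of \<open>n\<close> makes the trace of 1 equal to 1, so the trace is the
    identity on GF(2).\<close>
  have n1: "of_nat n = (1 :: 'l)"
    using of_nat_mod_CHAR[of n, where 'a = 'l] n unfolding two by (simp add: odd_iff_mod_2_eq_one)
  let ?G = "gf n \<times> gf (Suc 0) :: ('l \<times> 'l) set"
  let ?T = "ftrace n :: 'l \<Rightarrow> 'l"
  define b where "b s u v = ?T (s * fst u) * ?T (s * fst v) + ?T (s * s * (fst u * fst v))
      + snd u * ?T (s * fst v) + snd v * ?T (s * fst u)" for s and u v :: "'l \<times> 'l"
  \<comment> \<open>A quadratic form with polarisation \<open>b s\<close>: \<open>ftrace2\<close>
    gives the terms in the first coordinates, and the product gives the two mixed terms.\<close>
  define q where "q s u = ftrace2 n (s * fst u) + snd u * ?T (s * fst u)" for s and u :: "'l \<times> 'l"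
  have T: "?T x \<in> gf (Suc 0)" if "x \<in> gf n" for x using that by (rule ftrace_mem)
  note mem = T ftrace2_mem gf_add gf_mult
  have b_mem: "b s u v \<in> gf (Suc 0)" if "s \<in> gf n" "u \<in> ?G" "v \<in> ?G" for s u v
    using that by (auto simp: b_def intro!: mem)
  have q_mem: "q s u \<in> gf (Suc 0)" if "s \<in> gf n" "u \<in> ?G" for s u
    using that by (auto simp: q_def intro!: mem)
  have q_add: "q s (u + v) = q s u + q s v + b s u v" for s u v
    by (simp add: q_def b_def distrib_left ftrace_add ftrace2_add sub algebra_simps)
  have b_add: "b s u (v + w) = b s u v + b s u w" for s u v w
    by (simp add: b_def distrib_left ftrace_add algebra_simps)
  have b_nondeg: "\<exists>v\<in>?G. b s u v \<noteq> b t u v"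
    if s: "s \<in> gf n" and t: "t \<in> gf n" and st: "s \<noteq> t" and u: "u \<in> ?G" "u \<noteq> 0" for s t u
  proof (rule ccontr)
    assume "\<not> ?thesis"
    then have eq: "b s u v = b t u v" if "v \<in> ?G" for v using that by blast
    obtain x a where xa: "u = (x, a)" by (cases u)
    have x: "x \<in> gf n" and a: "a \<in> gf (Suc 0)" using u xa by auto
    have a': "a \<in> gf n" using a gf_1_subset by blast
    have "(0, 1) \<in> ?G" by simp
    from eq[OF this] have sx: "?T (s * x) = ?T (t * x)" by (simp add: b_def xa)
    define c where "c = ?T (s * x)"
    have c: "c \<in> gf (Suc 0)" unfolding c_def using s x by (intro T gf_mult)
    then have c': "c \<in> gf n" using gf_1_subset by blast
    \<comment> \<open>\<open>u\<close> is now assumed to lie in the radical of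
      \<open>b s - b t\<close>. Pairing it with \<open>(y, 0)\<close> amounts to
      \<open>?T (z * y)\<close>, with \<open>(s + t) * (s + t)\<close> standing for
      \<open>s * s + t * t\<close> in characteristic 2.\<close>
    define z where "z = (c + a) * (s + t) + (s + t) * (s + t) * x"
    have z: "z \<in> gf n" unfolding z_def using a' c' s t x by (intro gf_add gf_mult)
    have "?T (z * y) = 0" if y: "y \<in> gf n" for y
    proof -
      have "(y, 0) \<in> ?G" using y by simp
      from eq[OF this] have
        "c * ?T (s * y) + ?T (s * s * (x * y)) + a * ?T (s * y)
          = c * ?T (t * y) + ?T (t * t * (x * y)) + a * ?T (t * y)"
        unfolding b_def xa c_def by (simp add: sx)
      moreover have "z * y = (c + a) * (s * y + t * y) + (s * s * (x * y) + t * t * (x * y))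
          + (s * t * x * y + s * t * x * y)"
        by (simp add: z_def algebra_simps)
      then have "?T (z * y) = (c + a) * (?T (s * y) + ?T (t * y)) + (?T (s * s * (x * y)) + ?T (t * t * (x * y)))"
        using ftrace_scale[OF gf_add[OF c a]] by (simp add: ftrace_add self_add)
      then have "?T (z * y) = (c * ?T (s * y) + ?T (s * s * (x * y)) + a * ?T (s * y))
          + (c * ?T (t * y) + ?T (t * t * (x * y)) + a * ?T (t * y))"
        by (simp add: algebra_simps)
      ultimately show ?thesis by (simp only: self_add)
    qed
    then have "z = 0" using ftrace_nondegenerate[OF n0 z] zero_neq_one[where 'a = 'l] by force
    then have "(s + t) * (c + a + (s + t) * x) = 0" by (simp add: z_def algebra_simps)
    moreover have "s + t \<noteq> 0" unfolding sub[symmetric] using st by simp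
    ultimately have stx: "(s + t) * x = c + a" by (simp add: sub[symmetric])
    \<comment> \<open>Traces are compared in \<open>stx\<close>: the left side has trace 0, while
      \<open>c + a\<close> lies in GF(2) and is its own trace by \<open>n1\<close>. So
      \<open>c + a\<close> vanishes, then \<open>x\<close>, then \<open>c\<close> and
      \<open>a\<close>.\<close>
    have "?T ((s + t) * x) = 0" by (simp add: distrib_right ftrace_add sx self_add)
    then have "?T (c + a) = 0" using stx by simp
    then have "c + a = 0" using ftrace_scale[OF gf_add[OF c a], of n 1] by (simp add: ftrace_one n1)
    then have "x = 0" using stx \<open>s + t \<noteq> 0\<close> by simp
    then have "a = 0" using \<open>c + a = 0\<close> by (simp add: c_def)
    then show False using u xa \<open>x = 0\<close> by (simp add: zero_prod_def)
  qed
  let ?e = "\<lambda>u v. gf2_sign (?T (fst u * fst v) + snd u * snd v) :: real"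
  have e_mem: "?T (fst u * fst v) + snd u * snd v \<in> gf (Suc 0)" if "u \<in> ?G" "v \<in> ?G" for u v
    using that by (auto intro!: mem)
  interpret finite_additive_subgroup ?G
    using card_gf(2)[OF n0, where 'l = 'l] card_gf(2)[of "Suc 0", where 'l = 'l]
    by unfold_locales (auto simp: zero_prod_def intro!: gf_diff)
  \<comment> \<open>There is one form for each \<open>s\<close> in the field of order
    \<open>2 ^ n\<close>; the additional basis is the standard one.\<close>
  have q2: "CARD('m) div 2 = 2 ^ n" by (simp add: card)
  show ?thesis unfolding q2
  proof (rule mutually_unbiased_bases_of_quadratic_functions[where \<Sigma> = "gf n :: 'l set"
        and e = ?e and f = "\<lambda>s u. gf2_sign (q s u)" and \<beta> = "\<lambda>s u v. gf2_sign (b s u v)"])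
    show "card ?G = CARD('m)" "card (gf n :: 'l set) = 2 ^ n" "finite (gf n :: 'l set)"
      using n0 by (simp_all add: card_cartesian_product card_gf two card)
    show "?e (u + v) w = ?e u w * ?e v w" if "u \<in> ?G" "v \<in> ?G" "w \<in> ?G" for u v w
      using sign_add[OF e_mem[OF that(1,3)] e_mem[OF that(2,3)]]
      by (simp add: distrib_right ftrace_add add_ac)
    show "?e u (v + w) = ?e u v * ?e u w" if "u \<in> ?G" "v \<in> ?G" "w \<in> ?G" for u v w
      using sign_add[OF e_mem[OF that(1,2)] e_mem[OF that(1,3)]]
      by (simp add: distrib_left ftrace_add add_ac)
    show "\<exists>v\<in>?G. ?e u v \<noteq> 1" if u: "u \<in> ?G" "u \<noteq> 0" for u
    proof (cases "fst u = 0")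
      case True
      then have "snd u = 1" using u gf_1_char_2[OF two, of "snd u"] by (auto simp: prod_eq_iff)
      then show ?thesis using True by (intro bexI[of _ "(0, 1)"]) (simp_all add: sign_1)
    next
      case False
      have "fst u \<in> gf n" using u by auto
      from ftrace_nondegenerate[OF n0 this False] obtain y where "y \<in> gf n" "?T (fst u * y) = 1" .
      then show ?thesis by (intro bexI[of _ "(y, 0)"]) (simp_all add: sign_1)
    qed
    show "gf2_sign (q s (u + v)) = gf2_sign (q s u) * gf2_sign (q s v) * (gf2_sign (b s u v) :: real)"
      if "s \<in> gf n" "u \<in> ?G" "v \<in> ?G" for s u v
      using that by (simp only: q_add sign_add q_mem b_mem gf_add)
    show "gf2_sign (b s u (v + w)) = gf2_sign (b s u v) * (gf2_sign (b s u w) :: real)"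
      if "s \<in> gf n" "u \<in> ?G" "v \<in> ?G" "w \<in> ?G" for s u v w
      using that by (simp only: b_add sign_add b_mem)
    show "\<exists>v\<in>?G. gf2_sign (b s u v) \<noteq> (gf2_sign (b t u v) :: real)"
      if H: "s \<in> gf n" "t \<in> gf n" "s \<noteq> t" "u \<in> ?G" "u \<noteq> 0" for s t u
    proof -
      obtain v where v: "v \<in> ?G" "b s u v \<noteq> b t u v" using b_nondeg[OF H] by blast
      then have "gf2_sign (b s u v) \<noteq> (gf2_sign (b t u v) :: real)"
        using sign_inj[OF b_mem[OF H(1,4) v(1)] b_mem[OF H(2,4) v(1)]] by blast
      with v(1) show ?thesis by (rule bexI[rotated])
    qed
  qed (rule prime_field_character_unit[OF \<zeta>(3)])+
qed

section \<open>Fields of the required characteristic and the resulting bases\<close>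

instance alg_closure :: (field_prime_char) field_prime_char
  by (rule field_prime_charI') simp

text \<open>A type whose cardinality is the characteristic wanted for a field with \<open>CARD('m)\<close> elements.
  The value 2 serves only to make it an instance of \<^class>\<open>prime_card\<close> for every \<open>'m\<close>.\<close>

typedef 'm prime_index = "{..<(if primepow CARD('m) then aprimedivisor CARD('m) else 2)}"
proof -
  have "0 < (if primepow CARD('m) then aprimedivisor CARD('m) else 2)"
    by (auto simp: primepow_def aprimedivisor_prime_power prime_gt_0_nat)
  then show ?thesis by blast
qed

lemma card_prime_index:
  "CARD('m prime_index) = (if primepow CARD('m) then aprimedivisor CARD('m) else 2)"
  unfolding type_definition.card[OF type_definition_prime_index] by simp

instance prime_index :: (type) prime_card
  by standard (auto simp: card_prime_index primepow_def aprimedivisor_prime_power)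

theorem complex_mub_prime_power:
  assumes "primepow CARD('m::finite)"
  shows "\<exists>B :: nat \<Rightarrow> nat \<Rightarrow> complex^'m^'m. mutually_unbiased_bases (CARD('m) + 1) B"
proof -
  obtain p k where pk: "Factorial_Ring.prime p" "k > 0" "CARD('m) = p ^ k"
    using assms by (auto simp: primepow_def)
  then have "aprimedivisor CARD('m) = p" by (simp add: aprimedivisor_prime_power)
  then have "CHAR('m prime_index mod_ring alg_closure) = p"
    using assms by (simp add: card_prime_index)
  with pk show ?thesis
    using complex_mub_odd_characteristic[where 'l = "'m prime_index mod_ring alg_closure"]
      complex_mub_even_characteristic[where 'l = "'m prime_index mod_ring alg_closure"]
    by metis
qed

theorem real_mub_power_of_4:
  assumes "CARD('m::finite) = 4 ^ a" "a > 0"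
  shows "\<exists>B :: nat \<Rightarrow> nat \<Rightarrow> real^'m^'m. mutually_unbiased_bases (CARD('m) div 2 + 1) B"
proof (rule real_mub_kerdock[where 'l = "bool mod_ring alg_closure" and n = "2 * a - 1"])
  \<comment> \<open>\<open>bool\<close> serves as an index type with two elements, so
    \<open>bool mod_ring\<close> is GF(2).\<close>
  show "CHAR(bool mod_ring alg_closure) = 2" by simp
  show "odd (2 * a - 1)" using assms(2) by simp
  have "(4 :: nat) ^ a = 2 ^ (2 * a)" by (simp add: power_mult)
  then show "CARD('m) = 2 ^ (2 * a - 1 + 1)" using assms by simp
qed

theorem corollary5p5:
  fixes t l lam :: nat and S :: "nat set set"
  assumes "1 < l" and "l < CARD('m::finite) - 1"
    and "2 \<le> t" and "t \<le> l"
    and "symmetric_block_design t CARD('m) l lam S"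
  shows
    "(primepow CARD('m) \<longrightarrow>
        (\<exists>B :: nat \<Rightarrow> nat \<Rightarrow> complex^'m^'m. mutually_unbiased_bases (CARD('m) + 1) B) \<and>
        (\<forall>B :: nat \<Rightarrow> nat \<Rightarrow> complex^'m^'m. mutually_unbiased_bases (CARD('m) + 1) B \<longrightarrow>
           OGFF (CARD('m) * (CARD('m) + 1)) l ({1..CARD('m) + 1} \<times> S) (block_projection B) \<and>
           tight (CARD('m) * (CARD('m) + 1)) l ({1..CARD('m) + 1} \<times> S) (block_projection B)))
     \<and>
     ((\<exists>a. CARD('m) = 4 ^ a) \<longrightarrow>
        (\<exists>B :: nat \<Rightarrow> nat \<Rightarrow> real^'m^'m. mutually_unbiased_bases (CARD('m) div 2 + 1) B) \<and>
        (\<forall>B :: nat \<Rightarrow> nat \<Rightarrow> real^'m^'m. mutually_unbiased_bases (CARD('m) div 2 + 1) B \<longrightarrow>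
           OGFF (CARD('m) * (CARD('m) div 2 + 1)) l
             ({1..CARD('m) div 2 + 1} \<times> S) (block_projection B) \<and>
           tight (CARD('m) * (CARD('m) div 2 + 1)) l
             ({1..CARD('m) div 2 + 1} \<times> S) (block_projection B)))"
proof -
  have l: "l < CARD('m)" using assms(2) by simp
  note frame = OGFF_block_projections[OF l assms(3-5)] tight_block_projections[OF l assms(3-5)]
  have pos: "0 < CARD('m)" by simp
  \<comment> \<open>The left side is the square of \<open>m\<close>, the right side
    \<open>m * (m + 1)\<close>.\<close>
  have "herm_dim TYPE(complex) CARD('m) + 1 < real (CARD('m) * (CARD('m) + 1))"
    using pos by (simp add: herm_dim_complex_def power2_eq_square algebra_simps)
  then have complex: "OGFF (CARD('m) * (CARD('m) + 1)) l ({1..CARD('m) + 1} \<times> S) (block_projection B) \<and>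
      tight (CARD('m) * (CARD('m) + 1)) l ({1..CARD('m) + 1} \<times> S) (block_projection B)"
    if "mutually_unbiased_bases (CARD('m) + 1) B" for B :: "nat \<Rightarrow> nat \<Rightarrow> complex^'m^'m"
    using frame[OF that] pos by simp
  have real: "(\<exists>B :: nat \<Rightarrow> nat \<Rightarrow> real^'m^'m. mutually_unbiased_bases (CARD('m) div 2 + 1) B) \<and>
      (\<forall>B :: nat \<Rightarrow> nat \<Rightarrow> real^'m^'m. mutually_unbiased_bases (CARD('m) div 2 + 1) B \<longrightarrow>
        OGFF (CARD('m) * (CARD('m) div 2 + 1)) l
          ({1..CARD('m) div 2 + 1} \<times> S) (block_projection B) \<and>
        tight (CARD('m) * (CARD('m) div 2 + 1)) l
          ({1..CARD('m) div 2 + 1} \<times> S) (block_projection B))"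
    if a: "CARD('m) = 4 ^ a" for a
  proof (intro conjI allI impI)
    have "a > 0" using assms(1) l a by (cases a) simp_all
    then show "\<exists>B :: nat \<Rightarrow> nat \<Rightarrow> real^'m^'m. mutually_unbiased_bases (CARD('m) div 2 + 1) B"
      by (rule real_mub_power_of_4[OF a])
    from \<open>a > 0\<close> have "even CARD('m)" unfolding a by simp
    then obtain k where k: "CARD('m) = 2 * k" by (rule evenE)
    then have "k > 0" using pos by simp
    \<comment> \<open>The comparison is between \<open>m * (m + 1) / 2\<close> and
      \<open>m * (m + 2) / 2\<close>; writing \<open>m = 2 * k\<close> makes \<open>div\<close>
      exact.\<close>
    then have dim: "herm_dim TYPE(real) CARD('m) + 1 < real (CARD('m) * (CARD('m) div 2 + 1))"
      by (simp add: herm_dim_real_def k field_simps)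
    fix B :: "nat \<Rightarrow> nat \<Rightarrow> real^'m^'m"
    assume B: "mutually_unbiased_bases (CARD('m) div 2 + 1) B"
    show "OGFF (CARD('m) * (CARD('m) div 2 + 1)) l ({1..CARD('m) div 2 + 1} \<times> S) (block_projection B)"
      using frame(1)[OF B _ dim] k \<open>k > 0\<close> by simp
    show "tight (CARD('m) * (CARD('m) div 2 + 1)) l ({1..CARD('m) div 2 + 1} \<times> S) (block_projection B)"
      by (rule frame(2)[OF B])
  qed
  show ?thesis using complex real complex_mub_prime_power[where 'm = 'm] by blast
qed

end
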